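(* Let $\Delta$ be the $3$-dimensional simplicial complex on the vertex set $\{0,1,\dots,15\}$ generated by the following $72$ facets: $\{0,2,3,7\}$, $\{0,2,3,12\}$, $\{0,2,7,15\}$, $\{0,2,12,15\}$, $\{0,3,4,5\}$, $\{0,3,4,7\}$, $\{0,3,5,10\}$, $\{0,3,10,12\}$, $\{0,4,5,14\}$, $\{0,4,6,14\}$, $\{0,4,6,15\}$, $\{0,4,7,15\}$, $\{0,5,10,14\}$, $\{0,6,9,14\}$, $\{0,6,9,15\}$, $\{0,9,12,14\}$, $\{0,9,12,15\}$, $\{0,10,12,14\}$, $\{1,2,5,14\}$, $\{1,2,5,15\}$, $\{1,2,7,14\}$, $\{1,2,7,15\}$, $\{1,4,6,13\}$, $\{1,4,6,15\}$, $\{1,4,7,13\}$, $\{1,4,7,15\}$, $\{1,5,10,14\}$, $\{1,5,10,15\}$, $\{1,6,10,13\}$, $\{1,6,10,15\}$, $\{1,7,9,13\}$, $\{1,7,9,14\}$, $\{1,9,12,13\}$, $\{1,9,12,14\}$, $\{1,10,12,13\}$, $\{1,10,12,14\}$, $\{2,3,7,11\}$, $\{2,3,11,12\}$, $\{2,5,8,13\}$, $\{2,5,8,15\}$, $\{2,5,11,13\}$, $\{2,5,11,14\}$, $\{2,7,11,14\}$, $\{2,8,12,13\}$, $\{2,8,12,15\}$, $\{2,11,12,13\}$, $\{3,4,5,8\}$, $\{3,4,7,8\}$, $\{3,5,8,10\}$, $\{3,6,8,9\}$, $\{3,6,8,10\}$, $\{3,6,9,11\}$, $\{3,6,10,11\}$,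 $\{3,7,8,9\}$, $\{3,7,9,11\}$, $\{3,10,11,12\}$, $\{4,5,8,13\}$, $\{4,5,11,13\}$, $\{4,5,11,14\}$, $\{4,6,11,13\}$, $\{4,6,11,14\}$, $\{4,7,8,13\}$, $\{5,8,10,15\}$, $\{6,8,9,15\}$, $\{6,8,10,15\}$, $\{6,9,11,14\}$, $\{6,10,11,13\}$, $\{7,8,9,13\}$, $\{7,9,11,14\}$, $\{8,9,12,13\}$, $\{8,9,12,15\}$, $\{10,11,12,13\}$. Let $L$ be the triangulated $2$-sphere on the $11$ vertices $2,3,4,5,6,7,9,10,12,14,15$ generated by the $18$ triangles $\{2,3,7\}$, $\{2,3,12\}$, $\{2,7,15\}$, $\{2,12,15\}$, $\{3,4,5\}$, $\{3,4,7\}$, $\{3,5,10\}$, $\{3,10,12\}$, $\{4,5,14\}$, $\{4,6,14\}$, $\{4,6,15\}$, $\{4,7,15\}$, $\{5,10,14\}$, $\{6,9,14\}$, $\{6,9,15\}$, $\{9,12,14\}$, $\{9,12,15\}$, $\{10,12,14\}$. Then $\Delta$ is a balanced triangulation of the real projective space $\mathbb{R}\mathbf{P}^3$ on $16$ vertices; it is centrally symmetric; all its vertex links are isomorphic to the $2$-sphere $L$; and it is vertex minimal, i.e. every balanced triangulation of $\mathbb{R}\mathbf{P}^3$ has at least $16$ vertices.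
   Context: All simplicial complexes are finite abstract simplicial complexes; the complex generated by a collection of sets consists of all subsets of those sets. A triangulation of a topological space $X$ is a simplicial complex whose geometric realization is homeomorphic to $X$. A $3$-dimensional simplicial complex is balanced if there is a map $\kappa$ from its vertex set to $\{1,2,3,4\}$ with $\kappa(i)\neq\kappa(j)$ for every edge $\{i,j\}$. A simplicial complex is centrally symmetric if there is a free involution acting on it, i.e. a simplicial automorphism $\sigma$ with $\sigma^2=\mathrm{id}$ and $\sigma(F)\neq F$ for every nonempty face $F$. The link of a vertex $v$ is $\mathrm{lk}_\Delta(v)=\{G\in\Delta : v\notin G,\ G\cup\{v\}\in\Delta\}$. *)

theory Defs
  imports "HOL-Analysis.Analysis"
begin

section \<open>Finite abstract simplicial complexes\<close>

text \<open>
  A complex is the set of its faces.  The empty face belongs to every nonempty complex, in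
  particular to every generated complex and to every link of a vertex.  The vertex set of \<open>K\<close>
  is \<open>\<Union>K\<close>, so every vertex in it spans a \<open>0\<close>-dimensional face.

  The library notions \<open>simplicial_complex\<close> and \<open>triangulation\<close> concern sets of geometric
  simplices in a Euclidean space, hence the different names used here.
\<close>

definition finite_simplicial_complex :: "'v set set \<Rightarrow> bool" where
  "finite_simplicial_complex K \<longleftrightarrow>
     finite K \<and> (\<forall>F\<in>K. finite F) \<and> (\<forall>F\<in>K. \<forall>G. G \<subseteq> F \<longrightarrow> G \<in> K)"

definition generated_complex :: "'v set set \<Rightarrow> 'v set set" where
  "generated_complex A = {G. \<exists>F\<in>A. G \<subseteq> F}"

definition facets :: "'v set set \<Rightarrow> 'v set set" where
  "facets K = {F \<in> K. \<forall>G\<in>K. F \<subseteq> G \<longrightarrow> G = F}"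

definition complex_dim_eq :: "nat \<Rightarrow> 'v set set \<Rightarrow> bool" where
  "complex_dim_eq d K \<longleftrightarrow> (\<forall>F\<in>K. card F \<le> Suc d) \<and> (\<exists>F\<in>K. card F = Suc d)"

definition vertex_link :: "'v \<Rightarrow> 'v set set \<Rightarrow> 'v set set" where
  "vertex_link v K = {G \<in> K. v \<notin> G \<and> insert v G \<in> K}"

definition balanced3 :: "'v set set \<Rightarrow> bool" where
  "balanced3 K \<longleftrightarrow>
     complex_dim_eq 3 K \<and>
     (\<exists>\<kappa> :: 'v \<Rightarrow> nat. \<kappa> ` (\<Union>K) \<subseteq> {1,2,3,4} \<and>
        (\<forall>i j. i \<noteq> j \<longrightarrow> {i, j} \<in> K \<longrightarrow> \<kappa> i \<noteq> \<kappa> j))"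

definition simplicial_isomorphism :: "'v set set \<Rightarrow> 'w set set \<Rightarrow> ('v \<Rightarrow> 'w) \<Rightarrow> bool" where
  "simplicial_isomorphism K L f \<longleftrightarrow> bij_betw f (\<Union>K) (\<Union>L) \<and> image f ` K = L"

definition simplicially_isomorphic :: "'v set set \<Rightarrow> 'w set set \<Rightarrow> bool" where
  "simplicially_isomorphic K L \<longleftrightarrow> (\<exists>f. simplicial_isomorphism K L f)"

definition centrally_symmetric :: "'v set set \<Rightarrow> bool" where
  "centrally_symmetric K \<longleftrightarrow>
     (\<exists>\<sigma>. simplicial_isomorphism K K \<sigma> \<and>
          (\<forall>v\<in>\<Union>K. \<sigma> (\<sigma> v) = v) \<and>
          (\<forall>F\<in>K. F \<noteq> {} \<longrightarrow> \<sigma> ` F \<noteq> F))"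


section \<open>Geometric realization and triangulations\<close>

text \<open>
  Points are given by barycentric coordinates; the support of a point is the face containing it
  in its relative interior.  For finite complexes, to which this is applied, the topology of
  coordinatewise convergence is the usual topology of the realization.
\<close>

definition geometric_realization :: "'v set set \<Rightarrow> ('v \<Rightarrow> real) topology" where
  "geometric_realization K =
     subtopology (powertop_real UNIV)
       {x. (\<forall>v. 0 \<le> x v) \<and> {v. x v \<noteq> 0} \<in> K \<and> (\<Sum>v\<in>{v. x v \<noteq> 0}. x v) = 1}"

definition triangulates :: "'v set set \<Rightarrow> 'b topology \<Rightarrow> bool" where
  "triangulates K X \<longleftrightarrow>
     finite_simplicial_complex K \<and> geometric_realization K homeomorphic_space X"


section \<open>Real projective space\<close>

definition quotient_topology :: "'a topology \<Rightarrow> ('a \<Rightarrow> 'b) \<Rightarrow> 'b topology" where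
  "quotient_topology X q =
     topology (\<lambda>U. U \<subseteq> q ` topspace X \<and> openin X {x \<in> topspace X. q x \<in> U})"

lemma openin_quotient_topology:
  "openin (quotient_topology X q) U \<longleftrightarrow>
     U \<subseteq> q ` topspace X \<and> openin X {x \<in> topspace X. q x \<in> U}"
proof -
  have "istopology (\<lambda>U. U \<subseteq> q ` topspace X \<and> openin X {x \<in> topspace X. q x \<in> U})"
    unfolding istopology_def
  proof (intro conjI allI impI)
    fix S T
    assume S: "S \<subseteq> q ` topspace X \<and> openin X {x \<in> topspace X. q x \<in> S}"
      and T: "T \<subseteq> q ` topspace X \<and> openin X {x \<in> topspace X. q x \<in> T}"
    show "S \<inter> T \<subseteq> q ` topspace X" using S by blast
    have "{x \<in> topspace X. q x \<in> S \<inter> T} =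
          {x \<in> topspace X. q x \<in> S} \<inter> {x \<in> topspace X. q x \<in> T}" by blast
    then show "openin X {x \<in> topspace X. q x \<in> S \<inter> T}" using S T by auto
  next
    fix \<K>
    assume K: "\<forall>S\<in>\<K>. S \<subseteq> q ` topspace X \<and> openin X {x \<in> topspace X. q x \<in> S}"
    show "\<Union>\<K> \<subseteq> q ` topspace X" using K by blast
    have "{x \<in> topspace X. q x \<in> \<Union>\<K>} = (\<Union>S\<in>\<K>. {x \<in> topspace X. q x \<in> S})" by blast
    then show "openin X {x \<in> topspace X. q x \<in> \<Union>\<K>}" using K by auto
  qed
  then show ?thesis by (simp add: quotient_topology_def)
qed

lemma topspace_quotient_topology: "topspace (quotient_topology X q) = q ` topspace X"
proof
  show "topspace (quotient_topology X q) \<subseteq> q ` topspace X"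
    using openin_topspace [of "quotient_topology X q"]
    unfolding openin_quotient_topology by (rule conjunct1)
  have "{x \<in> topspace X. q x \<in> q ` topspace X} = topspace X" by blast
  then have "openin (quotient_topology X q) (q ` topspace X)"
    by (simp add: openin_quotient_topology)
  then show "q ` topspace X \<subseteq> topspace (quotient_topology X q)"
    by (rule openin_subset)
qed

lemma quotient_map_quotient_topology: "quotient_map X (quotient_topology X q) q"
  by (simp add: quotient_map_def topspace_quotient_topology openin_quotient_topology)

definition real_projective_space :: "nat \<Rightarrow> (nat \<Rightarrow> real) set topology" where
  "real_projective_space n = quotient_topology (nsphere n) (\<lambda>x. {x, (\<lambda>i. - x i)})"


section \<open>The two concrete complexes\<close>

definition Delta_facets :: "nat set set" where
  "Delta_facets =
   {{0,2,3,7}, {0,2,3,12}, {0,2,7,15}, {0,2,12,15}, {0,3,4,5}, {0,3,4,7},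
    {0,3,5,10}, {0,3,10,12}, {0,4,5,14}, {0,4,6,14}, {0,4,6,15}, {0,4,7,15},
    {0,5,10,14}, {0,6,9,14}, {0,6,9,15}, {0,9,12,14}, {0,9,12,15}, {0,10,12,14},
    {1,2,5,14}, {1,2,5,15}, {1,2,7,14}, {1,2,7,15}, {1,4,6,13}, {1,4,6,15},
    {1,4,7,13}, {1,4,7,15}, {1,5,10,14}, {1,5,10,15}, {1,6,10,13}, {1,6,10,15},
    {1,7,9,13}, {1,7,9,14}, {1,9,12,13}, {1,9,12,14}, {1,10,12,13}, {1,10,12,14},
    {2,3,7,11}, {2,3,11,12}, {2,5,8,13}, {2,5,8,15}, {2,5,11,13}, {2,5,11,14},
    {2,7,11,14}, {2,8,12,13}, {2,8,12,15}, {2,11,12,13}, {3,4,5,8}, {3,4,7,8},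
    {3,5,8,10}, {3,6,8,9}, {3,6,8,10}, {3,6,9,11}, {3,6,10,11}, {3,7,8,9},
    {3,7,9,11}, {3,10,11,12}, {4,5,8,13}, {4,5,11,13}, {4,5,11,14}, {4,6,11,13},
    {4,6,11,14}, {4,7,8,13}, {5,8,10,15}, {6,8,9,15}, {6,8,10,15}, {6,9,11,14},
    {6,10,11,13}, {7,8,9,13}, {7,9,11,14}, {8,9,12,13}, {8,9,12,15}, {10,11,12,13}}"

definition Delta :: "nat set set" where
  "Delta = generated_complex Delta_facets"

definition L_triangles :: "nat set set" where
  "L_triangles =
   {{2,3,7}, {2,3,12}, {2,7,15}, {2,12,15}, {3,4,5}, {3,4,7},
    {3,5,10}, {3,10,12}, {4,5,14}, {4,6,14}, {4,6,15}, {4,7,15},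
    {5,10,14}, {6,9,14}, {6,9,15}, {9,12,14}, {9,12,15}, {10,12,14}}"

definition L_sphere :: "nat set set" where
  "L_sphere = generated_complex L_triangles"

end

theory Submission
  imports Defs "HOL-Homology.Homology"
begin

text \<open>
  The two topological claims about \<open>Delta\<close> and \<open>L_sphere\<close> hold because both complexes come from
  convex polytopes.  For a simplicial polytope with the origin in its interior, radial projection
  is a homeomorphism from the boundary complex to the unit sphere (\<open>polytopal_sphere\<close>).
  An explicit polytope in \<open>\<real>\<^sup>3\<close> has boundary complex \<open>L_sphere\<close>.  For \<open>Delta\<close> there are points
  \<open>p\<^sub>v\<close> in \<open>\<real>\<^sup>4\<close>, one for each of the 16 vertices, such that the boundary of the convex hull of all
  \<open>\<plusminus>p\<^sub>v\<close> is a double cover of \<open>Delta\<close>: forgetting the signs maps its 144 facets two-to-one onto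
  the 72 facets of \<open>Delta\<close>, and identifies exactly the antipodal points.  So the realization of
  \<open>Delta\<close> and the projective space are quotients of the same sphere with the same fibres
  (\<open>forget_sign_fibre\<close>, \<open>triangulates_Delta\<close>).

  For the lower bound, every colour class of a balanced triangulation \<open>K\<close> of projective 3-space has
  at least four vertices, since the Lusternik-Schnirelmann category of the space is large enough.
  By invariance of domain all maximal faces of \<open>K\<close> have four vertices (\<open>maximal_face_card\<close>), hence
  contain every colour, and the closed stars of the vertices of one colour cover the realization.
  A closed star is contractible, so the double cover of projective space by the 3-sphere has a
  section over it (\<open>lift_of_closed_star\<close>).  The images of these sections are closed sets, disjoint
  from their antipodes, which together with their antipodes cover the 3-sphere.  By the
  Borsuk-Ulam theorem three such sets cannot suffice (\<open>Lusternik_Schnirelmann_nsphere3\<close>).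

  The remaining claims (the balanced colouring, the free involution, the isomorphisms of the links
  with \<open>L_sphere\<close>) are finite checks on explicit tables.
\<close>

section \<open>Geometric realizations\<close>

lemma topspace_realization:
  "topspace (geometric_realization K) =
     {x. (\<forall>v. 0 \<le> x v) \<and> {v. x v \<noteq> 0} \<in> K \<and> (\<Sum>v\<in>{v. x v \<noteq> 0}. x v) = 1}"
  by (simp add: geometric_realization_def)

lemma realization_sum:
  assumes "x \<in> topspace (geometric_realization K)" "finite V" "{v. x v \<noteq> 0} \<subseteq> V"
  shows "(\<Sum>v\<in>V. x v) = 1"
proof -
  have "(\<Sum>v\<in>{v. x v \<noteq> 0}. x v) = (\<Sum>v\<in>V. x v)"
    by (rule sum.mono_neutral_left) (use assms in auto)
  then show ?thesis using assms(1) by (simp add: topspace_realization)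
qed

lemma realization_support_nonempty:
  assumes "x \<in> topspace (geometric_realization K)"
  shows "{v. x v \<noteq> 0} \<noteq> {}"
proof
  assume "{v. x v \<noteq> 0} = {}"
  moreover have "(\<Sum>v\<in>{v. x v \<noteq> 0}. x v) = 1"
    using assms unfolding topspace_realization by blast
  ultimately show False by (simp only: sum.empty zero_neq_one)
qed

lemma realizationI:
  assumes "\<And>v. 0 \<le> x v" "{v. x v \<noteq> 0} \<subseteq> F" "F \<in> K" "finite F" "(\<Sum>v\<in>F. x v) = 1"
    and "\<And>G. G \<subseteq> F \<Longrightarrow> G \<in> K"
  shows "x \<in> topspace (geometric_realization K)"
proof -
  have "(\<Sum>v\<in>{v. x v \<noteq> 0}. x v) = (\<Sum>v\<in>F. x v)"
    by (rule sum.mono_neutral_left) (use assms in auto)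
  then show ?thesis using assms by (simp add: topspace_realization)
qed

lemma continuous_map_coordinate:
  "continuous_map (geometric_realization K) euclideanreal (\<lambda>x. x v)"
  unfolding geometric_realization_def
  by (blast intro: continuous_map_from_subtopology [OF continuous_map_product_projection])

lemma continuous_map_into_realization:
  "continuous_map X (geometric_realization K) f \<longleftrightarrow>
     (\<forall>v. continuous_map X euclideanreal (\<lambda>x. f x v)) \<and> f \<in> topspace X \<rightarrow> topspace (geometric_realization K)"
  by (auto simp: geometric_realization_def continuous_map_in_subtopology continuous_map_componentwise_UNIV)

lemma Hausdorff_realization: "Hausdorff_space (geometric_realization K)"
  unfolding geometric_realization_def
  by (intro Hausdorff_space_subtopology) (simp add: Hausdorff_space_product_topology)

lemma closedin_level_set:
  assumes "continuous_map X euclideanreal f" "closed C"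
  shows "closedin X {x \<in> topspace X. f x \<in> C}"
  using assms closedin_continuous_map_preimage by fastforce

lemma compact_realization:
  assumes K: "finite_simplicial_complex K"
  shows "compact_space (geometric_realization K)"
proof -
  define S where "S F = {x::'a \<Rightarrow> real. (\<forall>v. x v \<in> (if v \<in> F then {0..1} else {0})) \<and> (\<Sum>v\<in>F. x v) = 1}" for F
  have finK: "finite K" "\<And>F. F \<in> K \<Longrightarrow> finite F" "\<And>F G. F \<in> K \<Longrightarrow> G \<subseteq> F \<Longrightarrow> G \<in> K"
    using K by (auto simp: finite_simplicial_complex_def)
  have comp: "compactin (powertop_real UNIV) (S F)" if "F \<in> K" for F
  proof -
    have "compactin (powertop_real UNIV) (\<Pi>\<^sub>E v\<in>UNIV. if v \<in> F then {0..1} else {0})"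
      by (simp add: compactin_PiE)
    moreover have "closedin (powertop_real UNIV) {x \<in> topspace (powertop_real UNIV). (\<Sum>v\<in>F. x v) \<in> {1}}"
      by (intro closedin_level_set continuous_map_sum continuous_map_product_projection finK(2)[OF that]) auto
    ultimately have "compactin (powertop_real UNIV)
        ({x \<in> topspace (powertop_real UNIV). (\<Sum>v\<in>F. x v) \<in> {1}} \<inter> (\<Pi>\<^sub>E v\<in>UNIV. if v \<in> F then {0..1} else {0}))"
      by (intro closed_Int_compactin)
    also have "\<dots> = S F" by (auto simp: S_def PiE_def Pi_def)
    finally show ?thesis .
  qed
  have "{x. (\<forall>v. 0 \<le> x v) \<and> {v. x v \<noteq> 0} \<in> K \<and> (\<Sum>v\<in>{v. x v \<noteq> 0}. x v) = 1} = (\<Union>F\<in>K. S F)" (is "?A = ?B")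
  proof
    show "?A \<subseteq> ?B"
    proof
      fix x assume x: "x \<in> ?A"
      let ?F = "{v. x v \<noteq> 0}"
      have "x v \<le> 1" if "v \<in> ?F" for v
        using member_le_sum[of v ?F x] finK(2)[of ?F] that x by auto
      then have "x \<in> S ?F" using x by (auto simp: S_def)
      then show "x \<in> ?B" using x by blast
    qed
    show "?B \<subseteq> ?A"
    proof
      fix x assume "x \<in> ?B"
      then obtain F where x: "x \<in> S F" "F \<in> K" by blast
      have "x \<in> topspace (geometric_realization K)"
      proof (rule realizationI[of x F])
        show "{v. x v \<noteq> 0} \<subseteq> F" using x by (force simp: S_def split: if_splits)
        show "0 \<le> x v" for v
        proof -
          have "x v \<in> (if v \<in> F then {0..1} else {0})" using x(1) by (simp add: S_def)
          then show ?thesis by (simp split: if_splits)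
        qed
      qed (use x finK in \<open>auto simp: S_def\<close>)
      then show "x \<in> ?A" by (simp add: topspace_realization)
    qed
  qed
  moreover have "compactin (powertop_real UNIV) (\<Union>F\<in>K. S F)"
    by (intro compactin_Union) (use finK comp in auto)
  ultimately show ?thesis
    unfolding geometric_realization_def by (simp add: compact_space_subtopology)
qed

lemma generated_complex_image: "image f ` generated_complex A = generated_complex (image f ` A)"
proof
  show "image f ` generated_complex A \<subseteq> generated_complex (image f ` A)"
    by (auto simp: generated_complex_def)
  show "generated_complex (image f ` A) \<subseteq> image f ` generated_complex A"
    by (auto simp: generated_complex_def elim!: subset_imageE)
qed

lemma finite_simplicial_complex_generated:
  assumes "finite A" "\<And>F. F \<in> A \<Longrightarrow> finite F"
  shows "finite_simplicial_complex (generated_complex A)"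
proof -
  have "generated_complex A = (\<Union>F\<in>A. Pow F)" by (auto simp: generated_complex_def)
  then have "finite (generated_complex A)" using assms by simp
  then show ?thesis using assms
    by (auto simp: finite_simplicial_complex_def generated_complex_def intro: finite_subset)
qed

lemma Union_generated_complex: "\<Union>(generated_complex A) = \<Union>A"
  by (auto simp: generated_complex_def)


section \<open>Boundary complexes of simplicial polytopes\<close>

text \<open>
  A family that is dual to \<open>DIM('a)\<close> vectors forces them to be a basis and reads off the coordinates.
\<close>
lemma dual_basis_expansion:
  fixes p d :: "'v \<Rightarrow> 'a::euclidean_space"
  assumes "finite F" "card F = DIM('a)"
    and dual: "\<And>i j. i \<in> F \<Longrightarrow> j \<in> F \<Longrightarrow> d j \<bullet> p i = (if i = j then 1 else 0)"
  shows "y = (\<Sum>j\<in>F. (d j \<bullet> y) *\<^sub>R p j)"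
proof -
  have inj: "inj_on p F"
    by (rule inj_onI) (metis dual zero_neq_one)
  have lin: "d k \<bullet> (\<Sum>j\<in>F. c j *\<^sub>R p j) = c k" if "k \<in> F" for c k
  proof -
    have "d k \<bullet> (\<Sum>j\<in>F. c j *\<^sub>R p j) = (\<Sum>j\<in>F. if j = k then c j else 0)"
      unfolding inner_sum_right using that dual by (intro sum.cong) auto
    also have "\<dots> = c k" using that assms(1) by simp
    finally show ?thesis .
  qed
  have ind: "independent (p ` F)"
    unfolding independent_explicit
  proof (intro conjI allI impI ballI)
    show "finite (p ` F)" using assms(1) by simp
    fix c v assume c: "(\<Sum>v\<in>p ` F. c v *\<^sub>R v) = 0" and "v \<in> p ` F"
    then obtain k where k: "k \<in> F" "v = p k" by blast
    have "(\<Sum>j\<in>F. c (p j) *\<^sub>R p j) = 0" using c by (simp add: sum.reindex[OF inj])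
    then show "c v = 0" using lin[OF k(1), of "\<lambda>j. c (p j)"] k by simp
  qed
  have "UNIV \<subseteq> span (p ` F)"
    by (rule card_ge_dim_independent) (use ind assms card_image[OF inj] in \<open>auto simp: dim_UNIV\<close>)
  then obtain c where "y = (\<Sum>v\<in>p ` F. c v *\<^sub>R v)"
    using span_finite[of "p ` F"] assms(1) by blast
  then have y: "y = (\<Sum>j\<in>F. c (p j) *\<^sub>R p j)" by (simp add: sum.reindex[OF inj])
  then have "d k \<bullet> y = c (p k)" if "k \<in> F" for k using lin[OF that, of "\<lambda>j. c (p j)"] by simp
  then show ?thesis using y by simp
qed

text \<open>
  The index \<open>i\<close> runs over the facets of a simplicial polytope, and \<open>N i \<bullet> y = 1\<close> is the supporting
  hyperplane of the facet \<open>i\<close>.  The assumption \<open>ridge\<close> says that the facets close up.  It makes every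
  ray from the origin meet the boundary: for a point \<open>y\<close> of the ray take a facet \<open>i\<close> that maximizes
  \<open>N i \<bullet> y\<close>; comparison with the neighbouring facets shows that the coordinates of \<open>y\<close> with respect
  to the vertices of this facet are nonnegative.
\<close>
theorem polytopal_sphere:
  fixes p :: "'v \<Rightarrow> 'a::euclidean_space" and Fc :: "'i \<Rightarrow> 'v set" and N :: "'i \<Rightarrow> 'a"
  assumes I: "finite I" "I \<noteq> {}"
    and Fc: "\<And>i. i \<in> I \<Longrightarrow> finite (Fc i)" "\<And>i. i \<in> I \<Longrightarrow> card (Fc i) = DIM('a)"
    and on: "\<And>i v. i \<in> I \<Longrightarrow> v \<in> Fc i \<Longrightarrow> N i \<bullet> p v = 1"
    and off: "\<And>i j v. i \<in> I \<Longrightarrow> j \<in> I \<Longrightarrow> v \<in> Fc j \<Longrightarrow> v \<notin> Fc i \<Longrightarrow> N i \<bullet> p v < 1"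
    and ridge: "\<And>i v. i \<in> I \<Longrightarrow> v \<in> Fc i \<Longrightarrow> \<exists>j\<in>I. Fc i - {v} \<subseteq> Fc j \<and> v \<notin> Fc j"
  shows "homeomorphic_map (geometric_realization (generated_complex (Fc ` I))) (top_of_set (sphere 0 1))
     (\<lambda>x. sgn (\<Sum>v\<in>(\<Union>i\<in>I. Fc i). x v *\<^sub>R p v))"
proof -
  let ?K = "generated_complex (Fc ` I)"
  let ?R = "geometric_realization ?K"
  define V where "V = (\<Union>i\<in>I. Fc i)"
  define T where "T x = (\<Sum>v\<in>V. x v *\<^sub>R p v)" for x
  have finV: "finite V" using I Fc by (auto simp: V_def)
  have scK: "finite_simplicial_complex ?K"
    by (rule finite_simplicial_complex_generated) (use I Fc in auto)
  obtain nb where nb: "\<And>i v. i \<in> I \<Longrightarrow> v \<in> Fc i \<Longrightarrow> nb i v \<in> I \<and> Fc i - {v} \<subseteq> Fc (nb i v) \<and> v \<notin> Fc (nb i v)"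
    using ridge by metis
  \<comment> \<open>The difference of the normals of two adjacent facets vanishes on their common ridge, so it is,
     up to scaling, the dual vector of the vertex opposite to this ridge.\<close>
  define d where "d i v = (1 / (1 - N (nb i v) \<bullet> p v)) *\<^sub>R (N i - N (nb i v))" for i v
  have pos: "0 < 1 - N (nb i v) \<bullet> p v" if "i \<in> I" "v \<in> Fc i" for i v
    using off[of "nb i v" i v] nb[OF that] that by simp
  have dual: "d i j \<bullet> p k = (if k = j then 1 else 0)" if "i \<in> I" "j \<in> Fc i" "k \<in> Fc i" for i j k
  proof (cases "k = j")
    case True then show ?thesis
      using pos[OF that(1,2)] on[OF that(1,2)] by (simp add: d_def inner_diff_left)
  next
    case False
    then have "k \<in> Fc (nb i j)" using nb[OF that(1,2)] that by blast
    then show ?thesis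
      using False on[OF that(1,3)] on[of "nb i j" k] nb[OF that(1,2)] by (simp add: d_def inner_diff_left)
  qed
  have expand: "y = (\<Sum>j\<in>Fc i. (d i j \<bullet> y) *\<^sub>R p j)" if "i \<in> I" for i y
    by (rule dual_basis_expansion) (use that Fc dual in auto)
  have le1: "N i \<bullet> p v \<le> 1" if "i \<in> I" "v \<in> V" for i v
    using on[of i v] off[of i _ v] that by (fastforce simp: V_def)
  have supp: "\<exists>i\<in>I. {v. x v \<noteq> 0} \<subseteq> Fc i" if "x \<in> topspace ?R" for x
    using that by (auto simp: topspace_realization generated_complex_def)
  have x0: "0 \<le> x v" if "x \<in> topspace ?R" for x v
    using that by (auto simp: topspace_realization)
  have suppV: "{v. x v \<noteq> 0} \<subseteq> V" if "x \<in> topspace ?R" for x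
    using supp[OF that] by (auto simp: V_def)
  have sumV: "(\<Sum>v\<in>V. x v) = 1" if "x \<in> topspace ?R" for x
    by (rule realization_sum[OF that finV suppV[OF that]])
  have NT: "N i \<bullet> T x = (\<Sum>v\<in>V. x v * (N i \<bullet> p v))" for i x
    by (simp add: T_def inner_sum_right)
  have NTle: "N i \<bullet> T x \<le> 1" if "x \<in> topspace ?R" "i \<in> I" for i x
  proof -
    have "N i \<bullet> T x \<le> (\<Sum>v\<in>V. x v)"
      unfolding NT by (intro sum_mono) (use le1 that x0 in \<open>simp add: mult_left_le\<close>)
    then show ?thesis using sumV[OF that(1)] by simp
  qed
  have NT1: "N i \<bullet> T x = 1" if "x \<in> topspace ?R" "i \<in> I" "{v. x v \<noteq> 0} \<subseteq> Fc i" for i x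
  proof -
    have "N i \<bullet> T x = (\<Sum>v\<in>V. x v)"
      unfolding NT by (intro sum.cong) (use on that in auto)
    then show ?thesis using sumV[OF that(1)] by simp
  qed
  have NT1D: "{v. x v \<noteq> 0} \<subseteq> Fc i" if x: "x \<in> topspace ?R" "i \<in> I" "N i \<bullet> T x = 1" for i x
  proof -
    have "(\<Sum>v\<in>V. x v * (1 - N i \<bullet> p v)) = 0"
      using sumV[OF x(1)] x(3) by (simp add: NT right_diff_distrib sum_subtractf)
    then have z: "x v * (1 - N i \<bullet> p v) = 0" if "v \<in> V" for v
      using sum_nonneg_eq_0_iff[OF finV, of "\<lambda>v. x v * (1 - N i \<bullet> p v)"] le1 x x0 that
      by simp
    show ?thesis
    proof clarify
      fix v assume "x v \<noteq> 0"
      then have "v \<in> V" using suppV[OF x(1)] by auto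
      then have "N i \<bullet> p v = 1" using z[of v] \<open>x v \<noteq> 0\<close> by simp
      then show "v \<in> Fc i" using off[of i _ v] x(2) \<open>v \<in> V\<close> by (force simp: V_def)
    qed
  qed
  have coord: "x j = d i j \<bullet> T x" if "x \<in> topspace ?R" "i \<in> I" "{v. x v \<noteq> 0} \<subseteq> Fc i" "j \<in> Fc i" for x i j
  proof -
    have "T x = (\<Sum>v\<in>Fc i. x v *\<^sub>R p v)"
      unfolding T_def by (rule sum.mono_neutral_right) (use finV that in \<open>auto simp: V_def\<close>)
    then have "d i j \<bullet> T x = (\<Sum>v\<in>Fc i. if v = j then x v else 0)"
      using that dual by (simp add: inner_sum_right) (intro sum.cong, auto)
    then show ?thesis using that Fc by simp
  qed
  have T0: "T x \<noteq> 0" if "x \<in> topspace ?R" for x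
    using supp[OF that] NT1[OF that] by fastforce
  show ?thesis
    unfolding V_def[symmetric] T_def[symmetric]
  proof (rule continuous_imp_homeomorphic_map)
    show "compact_space ?R" by (rule compact_realization[OF scK])
    show "Hausdorff_space (top_of_set (sphere (0::'a) 1))"
      by (intro Hausdorff_space_subtopology) simp
    have "continuous_map ?R euclidean T"
      unfolding T_def
    proof (intro continuous_map_sum finV)
      fix v assume "v \<in> V"
      have "continuous_map euclideanreal euclidean (\<lambda>r. r *\<^sub>R p v)"
        by (auto intro!: continuous_intros)
      from continuous_map_compose[OF continuous_map_coordinate this]
      show "continuous_map ?R euclidean (\<lambda>x. x v *\<^sub>R p v)" by (simp add: o_def)
    qed
    then have "continuous_map ?R (top_of_set (- {0})) T"
      using T0 by (auto simp: continuous_map_in_subtopology)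
    moreover have "continuous_map (top_of_set (- {0::'a})) euclidean sgn"
      unfolding sgn_div_norm by (auto intro!: continuous_intros)
    ultimately have "continuous_map ?R euclidean (sgn \<circ> T)"
      by (rule continuous_map_compose)
    then show "continuous_map ?R (top_of_set (sphere 0 1)) (\<lambda>x. sgn (T x))"
      using T0 by (auto simp: continuous_map_in_subtopology o_def norm_sgn)
    show "inj_on (\<lambda>x. sgn (T x)) (topspace ?R)"
    proof (rule inj_onI)
      fix x y assume x: "x \<in> topspace ?R" and y: "y \<in> topspace ?R" and eq: "sgn (T x) = sgn (T y)"
      obtain i j where i: "i \<in> I" "{v. x v \<noteq> 0} \<subseteq> Fc i" and j: "j \<in> I" "{v. y v \<noteq> 0} \<subseteq> Fc j"
        using supp x y by meson
      define r where "r = norm (T x) / norm (T y)"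
      have r: "T x = r *\<^sub>R T y" "r > 0"
      proof -
        have "T x = norm (T x) *\<^sub>R sgn (T x)" using T0[OF x] by (simp add: sgn_div_norm)
        then show "T x = r *\<^sub>R T y" unfolding eq r_def by (simp add: sgn_div_norm divide_inverse)
        show "r > 0" using T0 x y by (simp add: r_def)
      qed
      have "1 \<le> r"
        using NT1[OF x i] mult_left_mono[OF NTle[OF y i(1)], of r] r by simp
      moreover have "r \<le> 1" using NT1[OF y j] NTle[OF x j(1)] r by simp
      ultimately have Teq: "T x = T y" using r by simp
      have si: "{v. y v \<noteq> 0} \<subseteq> Fc i" using NT1D[OF y i(1)] NT1[OF x i] Teq by simp
      show "x = y"
      proof
        fix v show "x v = y v"
        proof (cases "v \<in> Fc i")
          case True
          then show ?thesis using coord[OF x i] coord[OF y i(1) si] Teq by simp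
        next
          case False
          then have "x v = 0" "y v = 0" using i(2) si by auto
          then show ?thesis by simp
        qed
      qed
    qed
    show "(\<lambda>x. sgn (T x)) ` topspace ?R = topspace (top_of_set (sphere 0 1))"
    proof
      show "(\<lambda>x. sgn (T x)) ` topspace ?R \<subseteq> topspace (top_of_set (sphere 0 1))"
        using T0 by (auto simp: norm_sgn)
      show "topspace (top_of_set (sphere 0 1)) \<subseteq> (\<lambda>x. sgn (T x)) ` topspace ?R"
      proof
        fix y :: 'a assume "y \<in> topspace (top_of_set (sphere 0 1))"
        then have y: "norm y = 1" by simp
        obtain i where i: "i \<in> I" "\<And>j. j \<in> I \<Longrightarrow> N j \<bullet> y \<le> N i \<bullet> y"
        proof -
          have "Max ((\<lambda>j. N j \<bullet> y) ` I) \<in> (\<lambda>j. N j \<bullet> y) ` I" using I by (intro Max_in) auto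
          then obtain i where "i \<in> I" "N i \<bullet> y = Max ((\<lambda>j. N j \<bullet> y) ` I)" by auto
          then show ?thesis using I by (intro that[of i]) auto
        qed
        \<comment> \<open>The maximality of \<open>N i \<bullet> y\<close> is precisely the nonnegativity of these coordinates.\<close>
        define c where "c j = (if j \<in> Fc i then d i j \<bullet> y else 0)" for j
        have c0: "0 \<le> c j" for j
          using i(2)[of "nb i j"] nb[of i j] pos[of i j] i(1)
          by (auto simp: c_def d_def inner_diff_left intro!: mult_nonneg_nonneg)
        have ysum: "y = (\<Sum>j\<in>Fc i. c j *\<^sub>R p j)"
          using expand[OF i(1), of y] by (simp add: c_def)
        define s where "s = (\<Sum>j\<in>Fc i. c j)"
        have "s \<noteq> 0"
        proof
          assume "s = 0"
          then have "c j = 0" if "j \<in> Fc i" for j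
            using sum_nonneg_eq_0_iff[of "Fc i" c] c0 Fc i that by (auto simp: s_def)
          then have "y = 0" using ysum by simp
          then show False using y by simp
        qed
        moreover have "s \<ge> 0" using c0 by (simp add: s_def sum_nonneg)
        ultimately have s: "s > 0" by simp
        define x where "x j = c j / s" for j
        have x: "x \<in> topspace ?R"
        proof (rule realizationI[of x "Fc i"])
          show "0 \<le> x v" for v using c0 s by (simp add: x_def)
          show "{v. x v \<noteq> 0} \<subseteq> Fc i" by (auto simp: x_def c_def)
          show "sum x (Fc i) = 1" using s by (simp add: x_def sum_divide_distrib[symmetric] s_def[symmetric])
        qed (use i Fc in \<open>auto simp: generated_complex_def\<close>)
        have "T x = (\<Sum>v\<in>Fc i. x v *\<^sub>R p v)"
          unfolding T_def by (rule sum.mono_neutral_right) (use finV i in \<open>auto simp: V_def x_def c_def\<close>)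
        also have "\<dots> = (1 / s) *\<^sub>R y"
          by (simp add: ysum scaleR_sum_right x_def divide_inverse mult.commute)
        finally have "sgn (T x) = y" using s y by (simp add: sgn_div_norm)
        then show "y \<in> (\<lambda>x. sgn (T x)) ` topspace ?R" using x by blast
      qed
    qed
  qed
qed


section \<open>Spheres in tuple coordinates\<close>

definition emb4 :: "real \<times> real \<times> real \<times> real \<Rightarrow> nat \<Rightarrow> real" where
  "emb4 = (\<lambda>(a, b, c, d) i. if i = 0 then a else if i = 1 then b else if i = 2 then c else if i = 3 then d else 0)"

definition pr4 :: "(nat \<Rightarrow> real) \<Rightarrow> real \<times> real \<times> real \<times> real" where
  "pr4 y = (y 0, y 1, y 2, y 3)"

definition emb3 :: "real \<times> real \<times> real \<Rightarrow> nat \<Rightarrow> real" where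
  "emb3 = (\<lambda>(a, b, c) i. if i = 0 then a else if i = 1 then b else if i = 2 then c else 0)"

lemma norm_eq_1_4: "norm (a, b, c, d) = 1 \<longleftrightarrow> a\<^sup>2 + b\<^sup>2 + c\<^sup>2 + d\<^sup>2 = 1" for a b c d :: real
  by (simp add: norm_Pair real_sqrt_eq_1_iff add.assoc)

lemma norm_eq_1_3: "norm (a, b, c) = 1 \<longleftrightarrow> a\<^sup>2 + b\<^sup>2 + c\<^sup>2 = 1" for a b c :: real
  by (simp add: norm_Pair real_sqrt_eq_1_iff add.assoc)

lemma topspace_nsphere: "topspace (nsphere n) = {x. (\<Sum>i\<le>n. (x i)\<^sup>2) = 1 \<and> (\<forall>i>n. x i = 0)}"
  by (simp add: nsphere)

lemma continuous_map_into_nsphere: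
  "continuous_map X (nsphere n) f \<longleftrightarrow>
     (\<forall>i. continuous_map X euclideanreal (\<lambda>x. f x i)) \<and> f \<in> topspace X \<rightarrow> topspace (nsphere n)"
  by (auto simp: nsphere continuous_map_in_subtopology continuous_map_componentwise_UNIV)

lemma continuous_map_euclidean_Pair:
  assumes "continuous_map X euclidean f" "continuous_map X euclidean g"
  shows "continuous_map X euclidean (\<lambda>x. (f x, g x))"
  using continuous_map_pairedI[OF assms] by simp

lemma sphere_homeomorphic_nsphere3:
  "homeomorphic_maps (top_of_set (sphere 0 1)) (nsphere 3) emb4 pr4"
  unfolding homeomorphic_maps_def
proof (intro conjI ballI)
  have sum4: "(\<Sum>i\<le>3. (x i)\<^sup>2) = (x 0)\<^sup>2 + (x 1)\<^sup>2 + (x 2)\<^sup>2 + (x 3)\<^sup>2" for x :: "nat \<Rightarrow> real"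
    by (simp add: numeral_eq_Suc)
  have "continuous_on (sphere 0 1) (\<lambda>x. emb4 x i)" for i
    unfolding emb4_def split_def
    by (cases "i = 0"; cases "i = 1"; cases "i = 2"; cases "i = 3") (auto intro!: continuous_intros)
  then show "continuous_map (top_of_set (sphere 0 1)) (nsphere 3) emb4"
    by (auto simp: continuous_map_into_nsphere topspace_nsphere emb4_def sum4 norm_eq_1_4)
  show "continuous_map (nsphere 3) (top_of_set (sphere 0 1)) pr4"
    unfolding continuous_map_in_subtopology pr4_def
    by (intro conjI continuous_map_euclidean_Pair continuous_map_nsphere_projection)
       (auto simp: topspace_nsphere sum4 norm_eq_1_4)
  show "pr4 (emb4 x) = x" if "x \<in> topspace (top_of_set (sphere 0 1))" for x
    by (cases x) (simp add: pr4_def emb4_def)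
  show "emb4 (pr4 y) = y" if "y \<in> topspace (nsphere 3)" for y
  proof
    fix i :: nat
    consider "i = 0" | "i = 1" | "i = 2" | "i = 3" | "i > 3" by linarith
    then show "emb4 (pr4 y) i = y i"
      using that by cases (auto simp: pr4_def emb4_def topspace_nsphere)
  qed
qed

lemma sphere_homeomorphic_nsphere2:
  "homeomorphic_maps (top_of_set (sphere 0 1)) (nsphere 2) emb3 (\<lambda>y. (y 0, y 1, y 2))"
  unfolding homeomorphic_maps_def
proof (intro conjI ballI)
  have sum3: "(\<Sum>i\<le>2. (x i)\<^sup>2) = (x 0)\<^sup>2 + (x 1)\<^sup>2 + (x 2)\<^sup>2" for x :: "nat \<Rightarrow> real"
    by (simp add: numeral_eq_Suc)
  have "continuous_on (sphere 0 1) (\<lambda>x. emb3 x i)" for i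
    unfolding emb3_def split_def
    by (cases "i = 0"; cases "i = 1"; cases "i = 2") (auto intro!: continuous_intros)
  then show "continuous_map (top_of_set (sphere 0 1)) (nsphere 2) emb3"
    by (auto simp: continuous_map_into_nsphere topspace_nsphere emb3_def sum3 norm_eq_1_3)
  show "continuous_map (nsphere 2) (top_of_set (sphere 0 1)) (\<lambda>y. (y 0, y 1, y 2))"
    unfolding continuous_map_in_subtopology
    by (intro conjI continuous_map_euclidean_Pair continuous_map_nsphere_projection)
       (auto simp: topspace_nsphere sum3 norm_eq_1_3)
  show "(\<lambda>y. (y 0, y 1, y 2)) (emb3 x) = x" if "x \<in> topspace (top_of_set (sphere 0 1))" for x
    by (cases x) (simp add: emb3_def)
  show "emb3 ((\<lambda>y. (y 0, y 1, y 2)) y) = y" if "y \<in> topspace (nsphere 2)" for y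
  proof
    fix i :: nat
    consider "i = 0" | "i = 1" | "i = 2" | "i > 2" by linarith
    then show "emb3 ((\<lambda>y. (y 0, y 1, y 2)) y) i = y i"
      using that by cases (auto simp: emb3_def topspace_nsphere)
  qed
qed

lemma emb4_minus: "emb4 (- x) = (\<lambda>i. - emb4 x i)"
  by (cases x) (auto simp: emb4_def)

lemma pr4_minus: "pr4 (\<lambda>i. - y i) = - pr4 y"
  by (simp add: pr4_def)

lemma pr4_emb4: "pr4 (emb4 x) = x"
  by (cases x) (simp add: pr4_def emb4_def)

lemma compact_nsphere3: "compact_space (nsphere 3)"
proof -
  have "top_of_set (sphere (0::real \<times> real \<times> real \<times> real) 1) homeomorphic_space nsphere 3"
    using sphere_homeomorphic_nsphere3 homeomorphic_space_def by blast
  then show ?thesis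
    using homeomorphic_compact_space compact_space_subtopology compactin_euclidean_iff compact_sphere by blast
qed

lemma Hausdorff_nsphere: "Hausdorff_space (nsphere n)"
  unfolding nsphere by (intro Hausdorff_space_subtopology) (simp add: Hausdorff_space_product_topology)

lemma minus_in_nsphere: "(\<lambda>i. - x i) \<in> topspace (nsphere n) \<longleftrightarrow> x \<in> topspace (nsphere n)"
  by (simp add: topspace_nsphere)

lemma continuous_map_antipode: "continuous_map (nsphere n) (nsphere n) (\<lambda>x i. - x i)"
  by (auto simp: continuous_map_into_nsphere minus_in_nsphere continuous_map_nsphere_projection)


section \<open>The Borsuk--Ulam theorem for the 3-sphere\<close>

text \<open>
  If an odd self-map of the 3-sphere respects the flag of coordinate subspheres, then its degrees on
  consecutive subspheres have equal parity.  Here the degree is 1 on the 0-sphere, and it is 0 on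
  the 3-sphere because the image lies in the equator.
\<close>
lemma no_odd_map_flag:
  assumes cont: "continuous_map (nsphere 3) (nsphere 3) h"
    and odd: "\<And>y. y \<in> topspace (nsphere 3) \<Longrightarrow> h (\<lambda>i. - y i) = (\<lambda>i. - h y i)"
    and h3: "\<And>y. y \<in> topspace (nsphere 3) \<Longrightarrow> h y 3 = 0"
    and h2: "\<And>y. y \<in> topspace (nsphere (Suc 0)) \<Longrightarrow> h y 2 = 0"
    and h1: "\<And>y. y \<in> topspace (nsphere 0) \<Longrightarrow> h y = y"
  shows False
proof -
  have sub: "topspace (nsphere n) \<subseteq> topspace (nsphere (Suc n))" for n
    unfolding subtopology_nsphere_equator[of n, symmetric] topspace_subtopology by (rule Int_lower1)
  have sub12: "topspace (nsphere (Suc 0)) \<subseteq> topspace (nsphere 2)"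
    and sub23: "topspace (nsphere 2) \<subseteq> topspace (nsphere 3)"
    using sub[of "Suc 0"] sub[of 2] by (simp_all add: numeral_eq_Suc)
  have s23: "nsphere 2 = subtopology (nsphere 3) {x. x 3 = 0}"
    and s12: "nsphere (Suc 0) = subtopology (nsphere 2) {x. x 2 = 0}"
    using subtopology_nsphere_equator[of 2] subtopology_nsphere_equator[of "Suc 0"]
    by (simp_all add: numeral_eq_Suc)
  have im: "h y \<in> topspace (nsphere 3)" if "y \<in> topspace (nsphere 3)" for y
    using cont that by (auto simp: continuous_map_def)
  have im3: "h \<in> topspace (nsphere 3) \<rightarrow> topspace (nsphere 2)"
    using im h3 by (auto simp: s23)
  have cont2: "continuous_map (nsphere 2) (nsphere 2) h"
    unfolding s23 using cont im h3
    by (auto simp: continuous_map_in_subtopology continuous_map_from_subtopology)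
  have im2: "h \<in> topspace (nsphere (Suc 0)) \<rightarrow> topspace (nsphere (Suc 0))"
    using im3 h2 sub12 sub23 by (auto simp: s12)
  have cont1: "continuous_map (nsphere (Suc 0)) (nsphere (Suc 0)) h"
  proof -
    have "continuous_map (nsphere (Suc 0)) (nsphere 2) h"
      unfolding s12 using cont2 continuous_map_from_subtopology by blast
    then show ?thesis
      using im2 h2 by (subst s12) (auto simp: continuous_map_in_subtopology)
  qed
  have im1: "h \<in> topspace (nsphere 0) \<rightarrow> topspace (nsphere 0)"
    using h1 by auto
  have odd': "(h \<circ> (\<lambda>x i. - x i)) u = ((\<lambda>x i. - x i) \<circ> h) u" if "u \<in> topspace (nsphere 3)" for u
    using odd[OF that] by simp
  have "even (Brouwer_degree2 3 h - Brouwer_degree2 2 h)"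
    using Borsuk_odd_mapping_degree_step[OF cont odd'] im3 sub23 by (force simp: numeral_eq_Suc)
  moreover have "even (Brouwer_degree2 2 h - Brouwer_degree2 (Suc 0) h)"
    using Borsuk_odd_mapping_degree_step[OF cont2 odd'] im2 sub23 by (force simp: numeral_eq_Suc)
  moreover have "even (Brouwer_degree2 (Suc 0) h - Brouwer_degree2 0 h)"
    using Borsuk_odd_mapping_degree_step[OF cont1 odd'] im1 sub12 sub23 by force
  moreover have "Brouwer_degree2 0 h = 1"
    using Brouwer_degree2_eq[of 0 h id] h1 by simp
  moreover have "Brouwer_degree2 3 h = 0"
  proof (rule Brouwer_degree2_nonsurjective[OF cont])
    let ?pole = "\<lambda>i::nat. if i = 3 then 1 else 0 :: real"
    have "?pole \<in> topspace (nsphere 3)"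
      by (simp add: topspace_nsphere numeral_eq_Suc)
    moreover have "?pole \<notin> h ` topspace (nsphere 3)"
    proof
      assume "?pole \<in> h ` topspace (nsphere 3)"
      then obtain y where "?pole = h y" "y \<in> topspace (nsphere 3)" by blast
      then show False using h3[of y] fun_cong[of ?pole "h y" 3] by simp
    qed
    ultimately show "h ` topspace (nsphere 3) \<noteq> topspace (nsphere 3)" by blast
  qed
  ultimately show False by (auto simp: even_diff_iff)
qed

text \<open>
  A counterexample is deformed into a map excluded by \<open>no_odd_map_flag\<close>.  The maps need not be
  homotopic: it suffices that each modification is again odd and without zeros.  Passing to an odd
  polynomial makes the image of a great circle thin enough to miss a direction.
\<close>
theorem Borsuk_Ulam_3:
  fixes f :: "real \<times> real \<times> real \<times> real \<Rightarrow> real \<times> real \<times> real"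
  assumes cont: "continuous_on (sphere 0 1) f"
    and odd: "\<And>x. x \<in> sphere 0 1 \<Longrightarrow> f (- x) = - f x"
  shows "\<exists>x\<in>sphere 0 1. f x = 0"
proof (rule ccontr)
  assume "\<not> ?thesis"
  then have nz: "f x \<noteq> 0" if "x \<in> sphere 0 1" for x using that by blast
  let ?S = "sphere (0::real \<times> real \<times> real \<times> real) 1"
  have "?S \<noteq> {}" by simp
  obtain x0 where x0: "x0 \<in> ?S" "\<And>x. x \<in> ?S \<Longrightarrow> norm (f x0) \<le> norm (f x)"
    using continuous_attains_inf[OF compact_sphere \<open>?S \<noteq> {}\<close> continuous_on_norm[OF cont]] by metis
  define m where "m = norm (f x0)"
  have m: "m > 0" "\<And>x. x \<in> ?S \<Longrightarrow> m \<le> norm (f x)" using x0 nz by (auto simp: m_def)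
  obtain g where g: "polynomial_function g" "\<And>x. x \<in> ?S \<Longrightarrow> norm (f x - g x) < m"
    using Stone_Weierstrass_polynomial_function[OF compact_sphere cont m(1)] by blast
  define P where "P x = (1/2) *\<^sub>R (g x - g (- x))" for x
  have Podd: "P (- x) = - P x" for x by (simp add: P_def algebra_simps)
  have Pnz: "P x \<noteq> 0" if "x \<in> ?S" for x
  proof
    assume "P x = 0"
    have "f x - P x = (1/2) *\<^sub>R ((f x - g x) - (f (- x) - g (- x)))"
      unfolding P_def odd[OF that] by (simp add: algebra_simps) (simp add: scaleR_2[symmetric])
    then have "norm (f x - P x) \<le> (1/2) * (norm (f x - g x) + norm (f (- x) - g (- x)))"
      by (simp add: norm_triangle_ineq4)
    also have "\<dots> < m" using g(2)[of x] g(2)[of "- x"] that by simp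
    finally show False using m(2)[OF that] \<open>P x = 0\<close> by simp
  qed
  have gd: "g differentiable (at x)" for x
    using g(1) by (rule differentiable_at_polynomial_function)
  have Pd: "P differentiable (at x)" for x
  proof -
    have "(\<lambda>x. g (- x)) differentiable (at x)"
      using differentiable_chain_at[of uminus x g] gd by (simp add: o_def)
    then show ?thesis unfolding P_def using gd by (intro derivative_intros) auto
  qed
  define c :: "real \<times> real \<Rightarrow> real \<times> real \<times> real \<times> real" where "c t = (cos (snd t), sin (snd t), 0, 0)" for t
  have cd: "c differentiable (at t)" for t
  proof -
    have "(c has_derivative (\<lambda>h. (- sin (snd t) * snd h, cos (snd t) * snd h, 0, 0))) (at t)"
      unfolding c_def by (auto intro!: derivative_eq_intros simp: mult.commute zero_prod_def)
    then show ?thesis by (auto simp: differentiable_def)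
  qed
  \<comment> \<open>The cone over the image of the great circle \<open>c\<close> is a smooth image of a plane, so it misses a
     direction \<open>(al, be, ga)\<close>; a linear projection along this direction has no zero on the circle.\<close>
  define cone where "cone t = fst t *\<^sub>R P (c t)" for t :: "real \<times> real"
  have "cone differentiable_on UNIV"
  proof -
    have "(P \<circ> c) differentiable (at t)" for t
      using cd Pd by (intro differentiable_chain_at)
    moreover have "fst differentiable (at t)" for t :: "real \<times> real"
      using has_derivative_fst[OF has_derivative_ident] by (auto simp: differentiable_def)
    ultimately have "cone differentiable (at t)" for t
      unfolding cone_def by (intro differentiable_scaleR) (auto simp: o_def)
    then show ?thesis by (simp add: differentiable_on_def)
  qed
  then have "negligible (range cone)"
    by (intro negligible_differentiable_image_lowdim) auto
  moreover have "negligible {x. (0::real, 0::real, 1::real) \<bullet> x = 0}"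
    by (rule negligible_hyperplane) (simp add: zero_prod_def)
  ultimately have "negligible (range cone \<union> {x. (0::real, 0::real, 1::real) \<bullet> x = 0})"
    by (rule negligible_Un)
  then have "range cone \<union> {x. (0, 0, 1) \<bullet> x = 0} \<noteq> UNIV"
    using non_negligible_UNIV by metis
  then obtain al be ga where dir: "(al, be, ga) \<notin> range cone" "ga \<noteq> 0" by fastforce
  define P1 P2 P3 where "P1 x = fst (P x)" and "P2 x = fst (snd (P x))" and "P3 x = snd (snd (P x))" for x
  have Pcomp: "P x = (P1 x, P2 x, P3 x)" for x by (simp add: P1_def P2_def P3_def)
  define Q1 Q2 where "Q1 x = ga * P1 x - al * P3 x" and "Q2 x = ga * P2 x - be * P3 x" for x
  have Pcirc: "Q1 (a, b, 0, 0) \<noteq> 0 \<or> Q2 (a, b, 0, 0) \<noteq> 0" if ab: "a\<^sup>2 + b\<^sup>2 = 1" for a b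
  proof (rule ccontr)
    let ?x = "(a, b, 0, 0) :: real \<times> real \<times> real \<times> real"
    assume "\<not> ?thesis"
    then have q: "ga * P1 ?x = al * P3 ?x" "ga * P2 ?x = be * P3 ?x" by (auto simp: Q1_def Q2_def)
    have nz: "P ?x \<noteq> 0" using ab by (intro Pnz) (simp add: norm_eq_1_4)
    have P3: "P3 ?x \<noteq> 0"
    proof
      assume "P3 ?x = 0"
      then have "P1 ?x = 0" "P2 ?x = 0" using q dir(2) by auto
      then show False using nz \<open>P3 ?x = 0\<close> by (simp add: Pcomp zero_prod_def)
    qed
    obtain t where t: "a = cos t" "b = sin t" using sincos_total_2pi[OF ab] by metis
    have "cone (ga / P3 ?x, t) = (al, be, ga)"
      using q P3 by (simp add: cone_def c_def t Pcomp field_simps)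
    then show False using dir(1) by (metis rangeI)
  qed
  have Qnz: "Q1 x \<noteq> 0 \<or> Q2 x \<noteq> 0 \<or> P3 x \<noteq> 0" if "x \<in> ?S" for x
    using Pnz[OF that] dir(2) by (auto simp: Q1_def Q2_def Pcomp zero_prod_def)
  define e0 :: "real \<times> real \<times> real \<times> real" where "e0 = (1, 0, 0, 0)"
  define a b where "a = Q1 e0" and "b = Q2 e0"
  have ab: "a\<^sup>2 + b\<^sup>2 > 0"
    using Pcirc[of 1 0] by (auto simp: a_def b_def e0_def sum_power2_gt_zero_iff)
  \<comment> \<open>The factor in the third component puts the image of the great circle into the plane of the
     first two components.  The rotation by \<open>(a, b)\<close> in this plane sends \<open>e0\<close> to a positive multiple
     of itself.\<close>
  define H where "H x = (a * Q1 x + b * Q2 x, a * Q2 x - b * Q1 x,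
      ((fst (snd (snd x)))\<^sup>2 + (snd (snd (snd x)))\<^sup>2) * P3 x, 0::real)" for x
  have Hodd: "H (- x) = - H x" for x
    using Podd[of x] by (cases x) (simp add: H_def Q1_def Q2_def P1_def P2_def P3_def algebra_simps)
  have Hnz: "H x \<noteq> 0" if x: "x \<in> ?S" for x
  proof
    assume "H x = 0"
    obtain p q r s where pq: "x = (p, q, r, s)" by (cases x)
    have eqs: "a * Q1 x + b * Q2 x = 0" "a * Q2 x - b * Q1 x = 0" "(r\<^sup>2 + s\<^sup>2) * P3 x = 0"
      using \<open>H x = 0\<close> by (simp_all add: H_def zero_prod_def pq)
    have "(a\<^sup>2 + b\<^sup>2) * Q1 x = a * (a * Q1 x + b * Q2 x) - b * (a * Q2 x - b * Q1 x)"
      "(a\<^sup>2 + b\<^sup>2) * Q2 x = b * (a * Q1 x + b * Q2 x) + a * (a * Q2 x - b * Q1 x)"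
      by (simp_all add: power2_eq_square algebra_simps)
    then have "(a\<^sup>2 + b\<^sup>2) * Q1 x = 0" "(a\<^sup>2 + b\<^sup>2) * Q2 x = 0"
      unfolding eqs(1,2) by simp_all
    then have Q0: "Q1 x = 0" "Q2 x = 0" using ab by auto
    then have "P3 x \<noteq> 0" using Qnz[OF x] by simp
    then have "r\<^sup>2 + s\<^sup>2 = 0" using eqs(3) by simp
    then have "r = 0" "s = 0" by (simp_all add: sum_power2_eq_zero_iff)
    then show False using Pcirc[of p q] Q0 x by (simp add: pq norm_eq_1_4)
  qed
  have Pc: "continuous_on A P" for A
    using Pd by (simp add: continuous_at_imp_continuous_on differentiable_imp_continuous_within)
  have Hc: "continuous_on ?S H"
    unfolding H_def Q1_def Q2_def P1_def P2_def P3_def by (intro continuous_intros Pc)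
  define h where "h y = emb4 (sgn (H (pr4 y)))" for y
  show False
  proof (rule no_odd_map_flag[of h])
    have "continuous_map (top_of_set ?S) (top_of_set ?S) (\<lambda>x. sgn (H x))"
      using Hnz Hc by (auto simp: norm_sgn sgn_div_norm intro!: continuous_intros)
    then have "continuous_map (nsphere 3) (nsphere 3) (emb4 \<circ> ((\<lambda>x. sgn (H x)) \<circ> pr4))"
      using sphere_homeomorphic_nsphere3 unfolding homeomorphic_maps_def
      by (meson continuous_map_compose)
    then show "continuous_map (nsphere 3) (nsphere 3) h"
      by (simp add: h_def[abs_def] o_def)
    show "h (\<lambda>i. - y i) = (\<lambda>i. - h y i)" for y
      by (simp add: h_def pr4_minus Hodd sgn_minus emb4_minus)
    show "h y 3 = 0" for y
      by (simp add: h_def emb4_def H_def sgn_div_norm)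
    show "h y 2 = 0" if "y \<in> topspace (nsphere (Suc 0))" for y
    proof -
      have "y 2 = 0" "y 3 = 0" using that by (simp_all add: topspace_nsphere)
      then show ?thesis by (simp add: h_def emb4_def H_def sgn_div_norm pr4_def)
    qed
    have He0: "H e0 = (a\<^sup>2 + b\<^sup>2, 0, 0, 0)"
      by (simp add: H_def a_def[symmetric] b_def[symmetric] e0_def[symmetric] power2_eq_square)
         (simp add: e0_def)
    have se0: "sgn (H e0) = e0"
      unfolding He0 sgn_div_norm using ab by (simp add: norm_Pair e0_def) (metis left_inverse less_irrefl)
    show "h y = y" if y: "y \<in> topspace (nsphere 0)" for y
    proof -
      have y0: "y 0 = 1 \<or> y 0 = - 1" and yi: "\<And>i. i > 0 \<Longrightarrow> y i = 0"
        using y by (simp_all add: topspace_nsphere power2_eq_1_iff)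
      have em: "emb4 e0 = (\<lambda>i. if i = 0 then 1 else 0)" by (auto simp: emb4_def e0_def)
      from y0 show ?thesis
      proof
        assume 1: "y 0 = 1"
        then have "pr4 y = e0" using yi by (simp add: pr4_def e0_def)
        then show ?thesis using 1 yi by (auto simp: h_def se0 em)
      next
        assume 1: "y 0 = - 1"
        then have "pr4 y = - e0" using yi by (simp add: pr4_def e0_def)
        then show ?thesis using 1 yi by (auto simp: h_def Hodd sgn_minus se0 emb4_minus em)
      qed
    qed
  qed
qed

text \<open>
  Urysohn's lemma turns each \<open>A j\<close> into an odd function without zeros on \<open>A j\<close> and its antipode.  If
  these sets covered the sphere, then three such functions would have no common zero, contrary to
  the Borsuk-Ulam theorem.
\<close>
lemma Lusternik_Schnirelmann_nsphere3:
  assumes J: "finite J" "card J \<le> 3"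
    and closed: "\<And>j. j \<in> J \<Longrightarrow> closedin (nsphere 3) (A j)"
    and disj: "\<And>j y. j \<in> J \<Longrightarrow> y \<in> A j \<Longrightarrow> (\<lambda>i. - y i) \<notin> A j"
  shows "\<exists>y\<in>topspace (nsphere 3). \<forall>j\<in>J. y \<notin> A j \<and> (\<lambda>i. - y i) \<notin> A j"
proof (rule ccontr)
  assume "\<not> ?thesis"
  then have cover: "\<exists>j\<in>J. y \<in> A j \<or> (\<lambda>i. - y i) \<in> A j" if "y \<in> topspace (nsphere 3)" for y
    using that by blast
  have "\<exists>f. continuous_map (nsphere 3) euclideanreal f \<and> (\<forall>y\<in>topspace (nsphere 3). f (\<lambda>i. - y i) = - f y) \<and>
      (\<forall>y\<in>topspace (nsphere 3). y \<in> A j \<or> (\<lambda>i. - y i) \<in> A j \<longrightarrow> f y \<noteq> 0)" if j: "j \<in> J" for j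
  proof -
    let ?B = "{y \<in> topspace (nsphere 3). (\<lambda>i. - y i) \<in> A j}"
    have B: "closedin (nsphere 3) ?B"
      by (rule closedin_continuous_map_preimage[OF continuous_map_antipode closed[OF j]])
    have AB: "disjnt (A j) ?B"
      using disj[OF j] by (auto simp: disjnt_def)
    have "normal_space (nsphere 3)"
      using compact_nsphere3 Hausdorff_nsphere compact_Hausdorff_or_regular_imp_normal_space by blast
    from Urysohn_lemma_alt[OF this closed[OF j] B AB, of 1 0]
    obtain g where g: "continuous_map (nsphere 3) euclideanreal g"
        "g ` (A j) \<subseteq> {1}" "g ` ?B \<subseteq> {0}" .
    have "continuous_map (nsphere 3) euclideanreal (\<lambda>y. g (\<lambda>i. - y i))"
      using continuous_map_compose[OF continuous_map_antipode g(1)] by (simp add: o_def)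
    then have "continuous_map (nsphere 3) euclideanreal (\<lambda>y. g y - g (\<lambda>i. - y i))"
      using g(1) by (intro continuous_map_diff)
    moreover have "g y - g (\<lambda>i. - y i) \<noteq> 0"
      if y: "y \<in> topspace (nsphere 3)" and or: "y \<in> A j \<or> (\<lambda>i. - y i) \<in> A j" for y
      using or
    proof
      assume "y \<in> A j"
      moreover then have "(\<lambda>i. - y i) \<in> ?B" using y minus_in_nsphere by simp
      ultimately show ?thesis using g(2,3) by (simp add: image_subset_iff)
    next
      assume "(\<lambda>i. - y i) \<in> A j"
      moreover then have "y \<in> ?B" using y by simp
      ultimately show ?thesis using g(2,3) by (simp add: image_subset_iff)
    qed
    ultimately show ?thesis
      by (intro exI[of _ "\<lambda>y. g y - g (\<lambda>i. - y i)"]) simp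
  qed
  then obtain f where f: "\<And>j. j \<in> J \<Longrightarrow> continuous_map (nsphere 3) euclideanreal (f j)"
      "\<And>j y. j \<in> J \<Longrightarrow> y \<in> topspace (nsphere 3) \<Longrightarrow> f j (\<lambda>i. - y i) = - f j y"
      "\<And>j y. j \<in> J \<Longrightarrow> y \<in> topspace (nsphere 3) \<Longrightarrow> y \<in> A j \<or> (\<lambda>i. - y i) \<in> A j \<Longrightarrow> f j y \<noteq> 0"
    by metis
  obtain a b c where abc: "a \<in> J" "b \<in> J" "c \<in> J" "J = {a, b, c}"
  proof -
    have "J \<noteq> {}" using cover in_topspace_nsphere by fastforce
    have "card J = 1 \<or> card J = 2 \<or> card J = 3"
      using J \<open>J \<noteq> {}\<close> card_gt_0_iff[of J] by linarith
    then show ?thesis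
    proof (elim disjE)
      assume "card J = 1" then show ?thesis using that by (auto simp: card_1_singleton_iff)
    next
      assume "card J = 2" then show ?thesis using that by (auto simp: card_2_iff)
    next
      assume "card J = 3" then show ?thesis using that by (auto simp: card_3_iff)
    qed
  qed
  let ?S = "sphere (0::real \<times> real \<times> real \<times> real) 1"
  have emb: "emb4 x \<in> topspace (nsphere 3)" if "x \<in> ?S" for x
    using sphere_homeomorphic_nsphere3 that by (auto simp: homeomorphic_maps_def continuous_map_def)
  define F where "F x = (f a (emb4 x), f b (emb4 x), f c (emb4 x))" for x
  have "continuous_map (top_of_set ?S) (nsphere 3) emb4"
    using sphere_homeomorphic_nsphere3 by (simp add: homeomorphic_maps_def)
  then have "continuous_on ?S (\<lambda>x. f j (emb4 x))" if "j \<in> J" for j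
    using continuous_map_compose[OF _ f(1)[OF that]] by (fastforce simp: o_def)
  then have "continuous_on ?S F"
    unfolding F_def using abc by (intro continuous_on_Pair) auto
  moreover have "F (- x) = - F x" if "x \<in> ?S" for x
    using f(2) abc emb[OF that] by (simp add: F_def emb4_minus)
  ultimately obtain x where x: "x \<in> ?S" "F x = 0" using Borsuk_Ulam_3 by blast
  then have "f j (emb4 x) = 0" if "j \<in> J" for j
    using that abc by (auto simp: F_def zero_prod_def)
  then show False using cover[OF emb[OF x(1)]] f(3)[OF _ emb[OF x(1)]] by blast
qed


section \<open>Lifting homotopies from projective space to the sphere\<close>

abbreviation line :: "(nat \<Rightarrow> real) \<Rightarrow> (nat \<Rightarrow> real) set" where
  "line x \<equiv> {x, (\<lambda>i. - x i)}"

lemma line_eq_iff: "line x = line y \<longleftrightarrow> y = x \<or> y = (\<lambda>i. - x i)"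
  by (auto simp: doubleton_eq_iff fun_eq_iff)

lemma topspace_real_projective_space:
  "topspace (real_projective_space n) = line ` topspace (nsphere n)"
  by (simp add: real_projective_space_def topspace_quotient_topology)

lemma quotient_map_line: "quotient_map (nsphere n) (real_projective_space n) line"
  unfolding real_projective_space_def by (rule quotient_map_quotient_topology)

text \<open>
  The entries of the matrix \<open>x x\<^sup>T\<close>, which depends only on the line through \<open>x\<close>: these are the
  continuous functions on projective space through which lines are compared.
\<close>
definition line_entry :: "nat \<Rightarrow> nat \<Rightarrow> (nat \<Rightarrow> real) set \<Rightarrow> real" where
  "line_entry i j l = (let y = SOME y. y \<in> l in y i * y j)"

lemma line_entry_line: "line_entry i j (line x) = x i * x j"
proof -
  have "(SOME y. y \<in> line x) \<in> line x" by (rule someI[of _ x]) simp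
  then show ?thesis by (auto simp: line_entry_def Let_def)
qed

lemma continuous_map_line_entry:
  "continuous_map (real_projective_space n) euclideanreal (line_entry i j)"
proof -
  have "continuous_map (nsphere n) euclideanreal (line_entry i j \<circ> line)"
    by (simp only: o_def line_entry_line)
       (intro continuous_map_real_mult continuous_map_nsphere_projection)
  then show ?thesis
    using continuous_compose_quotient_map_eq[OF quotient_map_line] by blast
qed

text \<open>
  The homotopy lifting property of the double cover, for compact \<open>X\<close>, with only the end of the
  homotopy lifted.  By compactness the interval can be cut into \<open>N\<close> steps such that the lines at the
  two ends of a step are never orthogonal.  The lift is then transported over one step by orthogonal
  projection to the new line, followed by normalization.
\<close>
lemma lift_homotopy_to_sphere:
  fixes G :: "'a \<times> real \<Rightarrow> (nat \<Rightarrow> real) set"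
  assumes X: "compact_space X"
    and G: "continuous_map (prod_topology X (top_of_set {0..1})) (real_projective_space n) G"
    and u0: "continuous_map X (nsphere n) u0" "\<And>x. x \<in> topspace X \<Longrightarrow> G (x, 0) = line (u0 x)"
  shows "\<exists>u. continuous_map X (nsphere n) u \<and> (\<forall>x\<in>topspace X. G (x, 1) = line (u x))"
proof -
  let ?I = "top_of_set {0..1::real}"
  let ?Y = "prod_topology X (prod_topology ?I ?I)"
  have GE: "\<exists>z\<in>topspace (nsphere n). G (x, t) = line z" if "x \<in> topspace X" "t \<in> {0..1}" for x t
  proof -
    have "G (x, t) \<in> line ` topspace (nsphere n)"
      using continuous_map_image_subset_topspace[OF G] that
      by (simp add: topspace_real_projective_space image_subset_iff)
    then show ?thesis by blast
  qed
  have entG: "continuous_map Z euclideanreal (\<lambda>z. line_entry i j (G (f z, g z)))"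
    if "continuous_map Z X f" "continuous_map Z ?I g" for Z :: "'z topology" and f g i j
    using continuous_map_compose[OF continuous_map_compose[OF continuous_map_pairedI[OF that] G]
        continuous_map_line_entry] by (simp add: o_def)
  \<comment> \<open>The square of the cosine of the angle between the lines at times \<open>s\<close> and \<open>t\<close>.\<close>
  define D where "D x s t = (\<Sum>i\<le>n. \<Sum>j\<le>n. line_entry i j (G (x, s)) * line_entry i j (G (x, t)))" for x s t
  have Dsq: "D x s t = (\<Sum>i\<le>n. y i * z i)\<^sup>2" if "G (x, s) = line y" "G (x, t) = line z" for x s t y z
    unfolding D_def that line_entry_line
    by (simp add: power2_eq_square sum_product algebra_simps)
  have D1: "D x t t = 1" if "x \<in> topspace X" "t \<in> {0..1}" for x t
    using GE[OF that] Dsq[of x t _ t] by (auto simp: topspace_nsphere power2_eq_square)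
  have contD: "continuous_map Z euclideanreal (\<lambda>z. D (f z) (g z) (h z))"
    if "continuous_map Z X f" "continuous_map Z ?I g" "continuous_map Z ?I h" for Z :: "'z topology" and f g h
    unfolding D_def
    by (intro continuous_map_sum continuous_map_real_mult entG that) auto
  have proj: "continuous_map ?Y X fst" "continuous_map ?Y ?I (\<lambda>w. fst (snd w))" "continuous_map ?Y ?I (\<lambda>w. snd (snd w))"
    using continuous_map_compose[OF continuous_map_snd continuous_map_fst, of X ?I ?I]
      continuous_map_compose[OF continuous_map_snd continuous_map_snd, of X ?I ?I]
    by (simp_all add: continuous_map_fst o_def)
  obtain \<delta> where \<delta>: "\<delta> > 0"
    "\<And>x s t. x \<in> topspace X \<Longrightarrow> s \<in> {0..1} \<Longrightarrow> t \<in> {0..1} \<Longrightarrow> \<bar>s - t\<bar> < \<delta> \<Longrightarrow> D x s t \<noteq> 0"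
  proof -
    define B where "B = {w \<in> topspace ?Y. D (fst w) (fst (snd w)) (snd (snd w)) \<in> {0}}"
    define C where "C = (\<lambda>w. \<bar>fst (snd w) - snd (snd w)\<bar>) ` B"
    have cI: "compact_space ?I" by (simp add: compact_space_subtopology)
    have "compact_space ?Y" unfolding compact_space_prod_topology using X cI by blast
    moreover have "closedin ?Y B"
      unfolding B_def by (intro closedin_level_set contD proj) auto
    ultimately have "compactin ?Y B" by (rule closedin_compact_space)
    moreover have "continuous_map ?Y euclideanreal (\<lambda>w. \<bar>fst (snd w) - snd (snd w)\<bar>)"
      using proj(2,3) by (intro continuous_map_real_abs continuous_map_diff)
        (auto simp: continuous_map_in_subtopology)
    ultimately have "compactin euclideanreal C"
      unfolding C_def by (rule image_compactin)
    then have "open (- C)" by (simp add: compact_imp_closed open_Compl)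
    moreover have "0 \<in> - C"
      using D1 by (auto simp: C_def B_def)
    ultimately obtain e where e: "e > 0" "ball 0 e \<subseteq> - C" using open_contains_ball by blast
    show ?thesis
    proof (rule that[OF e(1)])
      fix x s t assume *: "x \<in> topspace X" "s \<in> {0..1}" "t \<in> {0..1}" "\<bar>s - t\<bar> < e"
      show "D x s t \<noteq> 0"
      proof
        assume "D x s t = 0"
        then have "(x, s, t) \<in> B" using * by (simp add: B_def)
        then have "\<bar>s - t\<bar> \<in> C" unfolding C_def by force
        moreover have "\<bar>s - t\<bar> \<in> ball 0 e" using * by simp
        ultimately show False using e by blast
      qed
    qed
  qed
  obtain N where N: "N > 0" "1 / real N < \<delta>"
    using \<delta>(1) nat_approx_posE by (metis of_nat_0_less_iff of_nat_Suc zero_less_Suc)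
  have "\<exists>u. continuous_map X (nsphere n) u \<and> (\<forall>x\<in>topspace X. G (x, real k / N) = line (u x))"
    if "k \<le> N" for k
    using that
  proof (induction k)
    case 0 then show ?case using u0 by auto
  next
    case (Suc k)
    then obtain u where u: "continuous_map X (nsphere n) u" "\<And>x. x \<in> topspace X \<Longrightarrow> G (x, real k / N) = line (u x)"
      by auto
    define s t where "s = real k / N" and "t = real (Suc k) / N"
    have st: "s \<in> {0..1}" "t \<in> {0..1}" "\<bar>s - t\<bar> < \<delta>"
      using Suc.prems N by (auto simp: s_def t_def field_simps)
    define v where "v x i = (\<Sum>j\<le>n. line_entry i j (G (x, t)) * u x j) / sqrt (D x s t)" for x i
    have v: "v x \<in> topspace (nsphere n) \<and> G (x, t) = line (v x)" if x: "x \<in> topspace X" for x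
    proof -
      obtain z where z: "z \<in> topspace (nsphere n)" "G (x, t) = line z" using GE[OF x st(2)] by blast
      define r where "r = (\<Sum>i\<le>n. z i * u x i)"
      have D: "D x s t = r\<^sup>2"
        using Dsq[of x s "u x" t z] u(2)[OF x] z by (simp add: s_def r_def mult.commute)
      then have "r \<noteq> 0" using \<delta>(2)[OF x st] by auto
      have vi: "v x i = z i * (r / \<bar>r\<bar>)" for i
        unfolding v_def z(2) line_entry_line D
        by (simp add: r_def sum_distrib_left mult.assoc)
      have "r / \<bar>r\<bar> = 1 \<or> r / \<bar>r\<bar> = - 1" using \<open>r \<noteq> 0\<close> by (auto simp: abs_if)
      moreover have "v x = (\<lambda>i. z i * (r / \<bar>r\<bar>))" using vi by (rule ext)
      ultimately have "v x = z \<or> v x = (\<lambda>i. - z i)" by (elim disjE) simp_all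
      then show ?thesis using z minus_in_nsphere line_eq_iff by metis
    qed
    have "continuous_map X euclideanreal (\<lambda>x. v x i)" for i
      unfolding v_def
    proof (intro continuous_map_real_divide continuous_map_sum continuous_map_real_mult continuous_map_sqrt)
      have c: "continuous_map X ?I (\<lambda>x. r)" if "r \<in> {0..1}" for r using that by simp
      show "continuous_map X euclideanreal (\<lambda>x. line_entry i j (G (x, t)))" for j
        by (intro entG c st) simp
      show "continuous_map X euclideanreal (\<lambda>x. u x j)" for j
        using u(1) by (simp add: continuous_map_into_nsphere)
      show "continuous_map X euclideanreal (\<lambda>x. D x s t)"
        by (intro contD c st) simp
    qed (use \<delta>(2) st in auto)
    then have "continuous_map X (nsphere n) v"
      using v by (auto simp: continuous_map_into_nsphere)
    then show ?case using v by (auto simp: t_def)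
  qed
  from this[of N] N show ?thesis by simp
qed


section \<open>The lower bound for balanced triangulations\<close>

definition closed_star :: "'v \<Rightarrow> 'v set set \<Rightarrow> ('v \<Rightarrow> real) set" where
  "closed_star v K = {x \<in> topspace (geometric_realization K). insert v {u. x u \<noteq> 0} \<in> K}"

lemma closedin_closed_star:
  assumes K: "finite_simplicial_complex K"
  shows "closedin (geometric_realization K) (closed_star v K)"
proof -
  have finK: "finite K" "\<And>F. F \<in> K \<Longrightarrow> finite F" "\<And>F G. F \<in> K \<Longrightarrow> G \<subseteq> F \<Longrightarrow> G \<in> K"
    using K by (auto simp: finite_simplicial_complex_def)
  let ?R = "geometric_realization K"
  let ?\<F> = "{F \<in> K. insert v F \<in> K}"
  have "closed_star v K = (\<Union>F\<in>?\<F>. {x \<in> topspace ?R. (\<Sum>u\<in>F. x u) \<in> {1}})"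
  proof
    show "closed_star v K \<subseteq> (\<Union>F\<in>?\<F>. {x \<in> topspace ?R. (\<Sum>u\<in>F. x u) \<in> {1}})"
      by (auto simp: closed_star_def topspace_realization)
    show "(\<Union>F\<in>?\<F>. {x \<in> topspace ?R. (\<Sum>u\<in>F. x u) \<in> {1}}) \<subseteq> closed_star v K"
    proof
      fix x assume "x \<in> (\<Union>F\<in>?\<F>. {x \<in> topspace ?R. (\<Sum>u\<in>F. x u) \<in> {1}})"
      then obtain F where F: "F \<in> K" "insert v F \<in> K" "x \<in> topspace ?R" "(\<Sum>u\<in>F. x u) = 1" by blast
      let ?S = "{u. x u \<noteq> 0}"
      have S: "?S \<in> K" "\<And>u. 0 \<le> x u" using F(3) by (auto simp: topspace_realization)
      have "(\<Sum>u\<in>F \<union> ?S. x u) = 1"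
        using F S finK by (intro realization_sum[OF F(3)]) auto
      moreover have "(\<Sum>u\<in>F \<union> ?S. x u) = (\<Sum>u\<in>F. x u) + (\<Sum>u\<in>?S - F. x u)"
        using sum.union_disjoint[of F "?S - F" x] F S finK by (simp add: Un_Diff_cancel)
      ultimately have "(\<Sum>u\<in>?S - F. x u) = 0" using F by simp
      then have "\<forall>u\<in>?S - F. x u = 0"
        using sum_nonneg_eq_0_iff[of "?S - F" x] S finK(2)[OF S(1)] by simp
      then have "insert v ?S \<subseteq> insert v F" by auto
      then show "x \<in> closed_star v K" using F finK(3)[OF F(2)] by (simp add: closed_star_def)
    qed
  qed
  moreover have "closedin ?R (\<Union>F\<in>?\<F>. {x \<in> topspace ?R. (\<Sum>u\<in>F. x u) \<in> {1}})"
  proof (intro closedin_Union ballI)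
    show "finite ((\<lambda>F. {x \<in> topspace ?R. (\<Sum>u\<in>F. x u) \<in> {1}}) ` ?\<F>)" using finK(1) by simp
    fix C assume "C \<in> (\<lambda>F. {x \<in> topspace ?R. (\<Sum>u\<in>F. x u) \<in> {1}}) ` ?\<F>"
    then obtain F where F: "F \<in> K" "C = {x \<in> topspace ?R. (\<Sum>u\<in>F. x u) \<in> {1}}" by blast
    show "closedin ?R C"
      unfolding F(2) by (intro closedin_level_set continuous_map_sum continuous_map_coordinate finK(2)[OF F(1)]) auto
  qed
  ultimately show ?thesis by simp
qed

text \<open>
  The closed star is a cone with apex \<open>v\<close>, so the restriction of \<open>\<phi>\<close> to it is the end of a homotopy that
  starts with a constant map, which can be lifted.
\<close>
lemma lift_of_closed_star:
  assumes K: "finite_simplicial_complex K" and v: "v \<in> \<Union>K"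
    and \<phi>: "continuous_map (geometric_realization K) (real_projective_space n) \<phi>"
  shows "\<exists>u. continuous_map (subtopology (geometric_realization K) (closed_star v K)) (nsphere n) u \<and>
     (\<forall>x\<in>closed_star v K. \<phi> x = line (u x))"
proof -
  have finK: "finite K" "\<And>F. F \<in> K \<Longrightarrow> finite F" "\<And>F G. F \<in> K \<Longrightarrow> G \<subseteq> F \<Longrightarrow> G \<in> K"
    using K by (auto simp: finite_simplicial_complex_def)
  let ?R = "geometric_realization K"
  let ?X = "subtopology ?R (closed_star v K)"
  let ?Y = "prod_topology ?X (top_of_set {0..1::real})"
  have sub: "closed_star v K \<subseteq> topspace ?R" by (auto simp: closed_star_def)
  have topX: "topspace ?X = closed_star v K" using sub by auto
  have compX: "compact_space ?X"
    using closedin_compact_space[OF compact_realization[OF K] closedin_closed_star[OF K]]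
    by (simp add: compact_space_subtopology)
  define e where "e u = (if u = v then 1 else 0 :: real)" for u
  define H where "H p u = (1 - snd p) * e u + snd p * fst p u" for p u
  have HR: "H (x, t) \<in> topspace ?R" if x: "x \<in> closed_star v K" and t: "t \<in> {0..1}" for x t
  proof (rule realizationI)
    let ?S = "{u. x u \<noteq> 0}"
    have xR: "x \<in> topspace ?R" "insert v ?S \<in> K" using x by (auto simp: closed_star_def)
    then have x0: "0 \<le> x u" for u by (simp add: topspace_realization)
    show "0 \<le> H (x, t) u" for u using x0 t by (simp add: H_def e_def)
    show "{u. H (x, t) u \<noteq> 0} \<subseteq> insert v ?S" by (auto simp: H_def e_def)
    show "insert v ?S \<in> K" by fact
    then show "G \<in> K" if "G \<subseteq> insert v ?S" for G using finK(3) that by blast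
    show fin: "finite (insert v ?S)" using finK(2)[OF xR(2)] .
    have "(\<Sum>u\<in>insert v ?S. x u) = 1"
      by (rule realization_sum[OF xR(1) fin]) auto
    moreover have "(\<Sum>u\<in>insert v ?S. e u) = 1"
      unfolding e_def using sum.delta[OF fin, of v "\<lambda>_. 1"] by simp
    moreover have "sum (H (x, t)) (insert v ?S) =
        (1 - t) * (\<Sum>u\<in>insert v ?S. e u) + t * (\<Sum>u\<in>insert v ?S. x u)"
      unfolding sum_distrib_left sum.distrib[symmetric] by (rule sum.cong) (simp_all add: H_def)
    ultimately show "sum (H (x, t)) (insert v ?S) = 1" by simp
  qed
  have "continuous_map ?Y ?R H"
    unfolding continuous_map_into_realization
  proof (intro conjI allI)
    have 1: "continuous_map ?Y euclideanreal snd"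
      using continuous_map_snd[of ?X "top_of_set {0..1::real}"] by (simp add: continuous_map_in_subtopology)
    have 2: "continuous_map ?Y euclideanreal (\<lambda>p. fst p u)" for u
      using continuous_map_compose[OF continuous_map_fst
          continuous_map_from_subtopology[OF continuous_map_coordinate]] by (simp add: o_def)
    show "continuous_map ?Y euclideanreal (\<lambda>p. H p u)" for u
      unfolding H_def by (intro continuous_map_add continuous_map_real_mult continuous_map_diff 1 2) auto
    show "H \<in> topspace ?Y \<rightarrow> topspace ?R" using HR sub by auto
  qed
  then have G: "continuous_map ?Y (real_projective_space n) (\<phi> \<circ> H)"
    using \<phi> by (rule continuous_map_compose)
  have He: "H (x, 0) = e" "H (x, 1) = x" for x by (simp_all add: H_def fun_eq_iff)
  have "e \<in> topspace ?R"
  proof (rule realizationI[of e "{v}"])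
    show "{v} \<in> K" using v finK(3) by blast
    then show "G \<in> K" if "G \<subseteq> {v}" for G using finK(3) that by blast
  qed (auto simp: e_def)
  then have "\<phi> e \<in> line ` topspace (nsphere n)"
    using continuous_map_image_subset_topspace[OF \<phi>] topspace_real_projective_space by blast
  then obtain y where y: "y \<in> topspace (nsphere n)" "\<phi> e = line y" by blast
  have "\<exists>u. continuous_map ?X (nsphere n) u \<and> (\<forall>x\<in>topspace ?X. (\<phi> \<circ> H) (x, 1) = line (u x))"
    by (rule lift_homotopy_to_sphere[OF compX G, of "\<lambda>_. y"]) (use y He in auto)
  then show ?thesis using He topX by simp
qed

text \<open>
  The images of the lifts of the closed stars are closed and disjoint from their antipodes.  If the
  stars covered the realization, then every point of the 3-sphere would lie in one of these images
  or in its antipode.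
\<close>
lemma three_closed_stars_not_cover:
  assumes K: "finite_simplicial_complex K"
    and \<phi>: "homeomorphic_map (geometric_realization K) (real_projective_space 3) \<phi>"
    and J: "finite J" "card J \<le> 3" "J \<subseteq> \<Union>K"
  shows "topspace (geometric_realization K) \<noteq> (\<Union>v\<in>J. closed_star v K)"
proof
  let ?R = "geometric_realization K"
  assume cover: "topspace ?R = (\<Union>v\<in>J. closed_star v K)"
  have c\<phi>: "continuous_map ?R (real_projective_space 3) \<phi>" and inj: "inj_on \<phi> (topspace ?R)"
    and sur: "\<phi> ` topspace ?R = topspace (real_projective_space 3)"
    using \<phi> by (auto simp: homeomorphic_eq_everything_map)
  have "\<exists>u. continuous_map (subtopology ?R (closed_star v K)) (nsphere 3) u \<and>
     (\<forall>x\<in>closed_star v K. \<phi> x = line (u x))" if "v \<in> J" for v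
  proof -
    have "v \<in> \<Union>K" using J(3) that by blast
    then show ?thesis by (rule lift_of_closed_star[OF K _ c\<phi>])
  qed
  then obtain u where u: "\<And>v. v \<in> J \<Longrightarrow> continuous_map (subtopology ?R (closed_star v K)) (nsphere 3) (u v)"
      "\<And>v x. v \<in> J \<Longrightarrow> x \<in> closed_star v K \<Longrightarrow> \<phi> x = line (u v x)"
    by metis
  define A where "A v = u v ` closed_star v K" for v
  have sub: "closed_star v K \<subseteq> topspace ?R" for v by (auto simp: closed_star_def)
  have "\<exists>y\<in>topspace (nsphere 3). \<forall>v\<in>J. y \<notin> A v \<and> (\<lambda>i. - y i) \<notin> A v"
  proof (rule Lusternik_Schnirelmann_nsphere3[OF J(1,2)])
    fix v assume v: "v \<in> J"
    have "compactin ?R (closed_star v K)"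
      using closedin_compact_space[OF compact_realization[OF K] closedin_closed_star[OF K]] .
    then have "compactin (subtopology ?R (closed_star v K)) (closed_star v K)"
      by (simp add: compactin_subtopology)
    then have "compactin (nsphere 3) (A v)"
      unfolding A_def using u(1)[OF v] image_compactin by blast
    then show "closedin (nsphere 3) (A v)"
      using Hausdorff_nsphere compactin_imp_closedin by blast
    fix y assume "y \<in> A v"
    then obtain x where x: "x \<in> closed_star v K" "y = u v x" by (auto simp: A_def)
    show "(\<lambda>i. - y i) \<notin> A v"
    proof
      assume "(\<lambda>i. - y i) \<in> A v"
      then obtain x' where x': "x' \<in> closed_star v K" "(\<lambda>i. - y i) = u v x'" by (auto simp: A_def)
      have "line (u v x) = line (u v x')"
        by (simp only: line_eq_iff x(2)[symmetric] x'(2)[symmetric]) simp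
      then have "\<phi> x = \<phi> x'" by (simp only: u(2)[OF v x(1)] u(2)[OF v x'(1)])
      then have "x = x'" using inj x x' sub by (meson inj_onD subsetD)
      then have "(\<lambda>i. - y i) = y" using x x' by simp
      then have "y i = 0" for i by (metis equal_neg_zero neg_equal_zero)
      moreover have "y \<in> topspace (nsphere 3)"
        using u(1)[OF v] x sub by (auto simp: continuous_map_def)
      ultimately show False by (simp add: topspace_nsphere)
    qed
  qed
  then obtain y where y: "y \<in> topspace (nsphere 3)" "\<And>v. v \<in> J \<Longrightarrow> y \<notin> A v \<and> (\<lambda>i. - y i) \<notin> A v"
    by blast
  then have "line y \<in> \<phi> ` topspace ?R" using sur topspace_real_projective_space by blast
  then obtain x where x: "x \<in> topspace ?R" "line y = \<phi> x" by blast
  then obtain v where v: "v \<in> J" "x \<in> closed_star v K" using cover by blast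
  then have "line y = line (u v x)" using u(2) x by simp
  then have "u v x = y \<or> u v x = (\<lambda>i. - y i)" by (simp only: line_eq_iff)
  moreover have "u v x \<in> A v" using v(2) by (simp add: A_def)
  ultimately show False using y(2)[OF v(1)] by auto
qed

lemma subset_doubleton:
  assumes "finite S" "card S \<le> 2"
  shows "\<exists>a b. S \<subseteq> {a, b}"
proof -
  consider "card S = 0" | "card S = 1" | "card S = 2" using assms by linarith
  then show ?thesis
    by cases (use assms in \<open>auto simp: card_1_singleton_iff card_2_iff\<close>)
qed

text \<open>
  The relative interior of a maximal face is open in the realization.  If the face had at most three
  vertices, then two barycentric coordinates would embed this open set into the plane.
\<close>
lemma maximal_face_card:
  assumes K: "finite_simplicial_complex K"
    and \<phi>: "homeomorphic_map (geometric_realization K) (real_projective_space 3) \<phi>"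
    and F: "F \<in> K" "F \<noteq> {}" "\<And>G. G \<in> K \<Longrightarrow> F \<subseteq> G \<Longrightarrow> G = F"
  shows "4 \<le> card F"
proof (rule ccontr)
  assume "\<not> 4 \<le> card F"
  let ?R = "geometric_realization K"
  have finF: "finite F" using K F by (auto simp: finite_simplicial_complex_def)
  obtain c where c: "c \<in> F" using F by blast
  have "card (F - {c}) \<le> 2" using \<open>\<not> 4 \<le> card F\<close> c finF by simp
  then obtain a b where ab: "F - {c} \<subseteq> {a, b}" using subset_doubleton[of "F - {c}"] finF by blast
  obtain \<psi> where \<psi>: "homeomorphic_maps ?R (real_projective_space 3) \<phi> \<psi>"
    using \<phi> homeomorphic_map_maps by blast
  define M where "M y = \<psi> (line (emb4 (sgn y)))" for y
  let ?P = "top_of_set (- {0 :: real \<times> real \<times> real \<times> real})"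
  have contM: "continuous_map ?P ?R M"
  proof -
    have "continuous_map ?P (top_of_set (sphere 0 1)) sgn"
      unfolding continuous_map_in_subtopology
      by (auto simp: sgn_div_norm norm_sgn intro!: continuous_intros)
    moreover have "continuous_map (top_of_set (sphere 0 1)) (nsphere 3) emb4"
      using sphere_homeomorphic_nsphere3 by (simp add: homeomorphic_maps_def)
    moreover have "continuous_map (nsphere 3) (real_projective_space 3) line"
      by (rule quotient_imp_continuous_map[OF quotient_map_line])
    moreover have "continuous_map (real_projective_space 3) ?R \<psi>"
      using \<psi> by (simp add: homeomorphic_maps_def)
    ultimately have "continuous_map ?P ?R (\<psi> \<circ> (line \<circ> (emb4 \<circ> sgn)))"
      by (intro continuous_map_compose)
    then show ?thesis by (simp add: M_def[abs_def] o_def)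
  qed
  have emb: "emb4 x \<in> topspace (nsphere 3)" if "norm x = 1" for x
    using sphere_homeomorphic_nsphere3 that by (auto simp: homeomorphic_maps_def continuous_map_def)
  have injM: "sgn y = sgn y' \<or> sgn y = - sgn y'" if "y \<noteq> 0" "y' \<noteq> 0" "M y = M y'" for y y'
  proof -
    have "line (emb4 (sgn z)) \<in> topspace (real_projective_space 3)" if "z \<noteq> 0" for z
      unfolding topspace_real_projective_space by (intro imageI emb) (simp add: norm_sgn that)
    then have "\<phi> (M z) = line (emb4 (sgn z))" if "z \<noteq> 0" for z
      using \<psi> that by (simp add: homeomorphic_maps_def M_def)
    then have "line (emb4 (sgn y)) = line (emb4 (sgn y'))" using that by metis
    then have "emb4 (sgn y') = emb4 (sgn y) \<or> emb4 (sgn y') = emb4 (- sgn y)"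
      by (simp only: line_eq_iff emb4_minus)
    moreover have "pr4 (emb4 z) = z" for z by (cases z) (simp add: pr4_def emb4_def)
    ultimately show ?thesis by (metis minus_minus)
  qed
  define U where "U = {x \<in> topspace ?R. (\<Prod>v\<in>F. x v) \<in> - {0}}"
  have U: "openin ?R U"
    unfolding U_def
    by (rule openin_continuous_map_preimage[where Y = euclideanreal])
       (auto intro!: continuous_map_prod continuous_map_coordinate finF)
  have suppU: "{v. x v \<noteq> 0} = F" if "x \<in> U" for x
  proof (rule F(3))
    show "{v. x v \<noteq> 0} \<in> K" using that by (simp add: U_def topspace_realization)
    show "F \<subseteq> {v. x v \<noteq> 0}" using that finF by (auto simp: U_def)
  qed
  have Ueq: "x = y" if "x \<in> U" "y \<in> U" "x a = y a" "x b = y b" for x y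
  proof
    have sums: "(\<Sum>v\<in>F. x v) = 1" "(\<Sum>v\<in>F. y v) = 1"
      using that suppU finF by (auto intro!: realization_sum simp: U_def)
    have "(\<Sum>v\<in>F - {c}. x v) = (\<Sum>v\<in>F - {c}. y v)"
      using ab that by (intro sum.cong) auto
    then have "x c = y c" using sums c finF by (simp add: sum.remove[of F c])
    fix v
    show "x v = y v"
    proof (cases "v \<in> F")
      case True then show ?thesis using ab that \<open>x c = y c\<close> by auto
    next
      case False
      then have "v \<notin> {v. x v \<noteq> 0}" "v \<notin> {v. y v \<noteq> 0}"
        using suppU that by blast+
      then show ?thesis by simp
    qed
  qed
  define x0 where "x0 v = (if v \<in> F then 1 / card F else 0 :: real)" for v
  have "x0 \<in> topspace ?R"
    using F finF K
    by (intro realizationI[of x0 F]) (auto simp: x0_def finite_simplicial_complex_def)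
  then have x0: "x0 \<in> U" using finF F(2) by (simp add: U_def x0_def)
  have "\<phi> x0 \<in> line ` topspace (nsphere 3)"
    using \<phi> x0 by (auto simp: homeomorphic_eq_everything_map topspace_real_projective_space[symmetric] U_def)
  then obtain z where z: "z \<in> topspace (nsphere 3)" "\<phi> x0 = line z" by blast
  define y0 where "y0 = pr4 z"
  have y0: "norm y0 = 1" "emb4 y0 = z"
    using sphere_homeomorphic_nsphere3 z
    by (auto simp: homeomorphic_maps_def continuous_map_def y0_def)
  have My0: "M y0 = x0"
  proof -
    have "sgn y0 = y0" using y0(1) by (simp add: sgn_div_norm)
    then have "M y0 = \<psi> (\<phi> x0)" by (simp only: M_def y0(2) z(2))
    then show ?thesis using \<psi> x0 by (simp add: homeomorphic_maps_def U_def)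
  qed
  \<comment> \<open>A chart of projective space is avoided by working in the open cone over the preimage in the
     sphere.  The half-space selects one of two antipodal points, and the norm is the additional
     coordinate in \<open>f\<close>.\<close>
  define W where "W = {y \<in> - {0}. M y \<in> U} \<inter> {y. 0 < y0 \<bullet> y}"
  have "openin ?P {y \<in> topspace ?P. M y \<in> U}"
    by (rule openin_continuous_map_preimage[OF contM U])
  then have "open {y \<in> - {0}. M y \<in> U}"
    using openin_open_trans[OF _ open_Compl[OF closed_singleton]] by simp
  then have "open W"
    unfolding W_def by (intro open_Int open_halfspace_gt)
  moreover have "y0 \<in> W"
    using y0 My0 x0 by (auto simp: W_def dot_square_norm)
  moreover define f where "f y = (norm y, M y a, M y b)" for y
  have "continuous_on W f"
  proof -
    have "continuous_map ?P euclideanreal (\<lambda>y. M y v)" for v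
      using continuous_map_compose[OF contM continuous_map_coordinate] by (simp add: o_def)
    then have "continuous_on W (\<lambda>y. M y v)" for v
      by (auto intro: continuous_on_subset simp: W_def)
    then show ?thesis unfolding f_def by (intro continuous_intros)
  qed
  moreover have "inj_on f W"
  proof (rule inj_onI)
    fix y y' assume y: "y \<in> W" "y' \<in> W" "f y = f y'"
    then have "M y = M y'" by (intro Ueq) (auto simp: W_def f_def)
    then have "sgn y = sgn y' \<or> sgn y = - sgn y'" using y by (intro injM) (auto simp: W_def)
    moreover have n: "norm y = norm y'" using y by (simp add: f_def)
    moreover have "z = norm z *\<^sub>R sgn z" for z :: "real \<times> real \<times> real \<times> real"
      by (cases "z = 0") (simp_all add: sgn_div_norm)
    moreover have "y \<noteq> - y'" using y by (auto simp: W_def)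
    ultimately show "y = y'" by (metis scaleR_minus_right)
  qed
  ultimately have "DIM(real \<times> real \<times> real \<times> real) \<le> DIM(real \<times> real \<times> real)"
    using invariance_of_dimension[of W f] by blast
  then show False by simp
qed

text \<open>
  A maximal face has four vertices of distinct colours, so it meets every colour class; therefore the
  closed stars of any colour class cover the realization, and each class has at least four elements.
\<close>
theorem balanced_RP3_vertices:
  fixes K :: "'v set set"
  assumes bal: "balanced3 K" and tri: "triangulates K (real_projective_space 3)"
  shows "16 \<le> card (\<Union>K)"
proof -
  have K: "finite_simplicial_complex K" using tri by (simp add: triangulates_def)
  then have finK: "finite K" "\<And>F. F \<in> K \<Longrightarrow> finite F" "\<And>F G. F \<in> K \<Longrightarrow> G \<subseteq> F \<Longrightarrow> G \<in> K"
    by (auto simp: finite_simplicial_complex_def)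
  have finV: "finite (\<Union>K)" using finK by blast
  obtain \<phi> where \<phi>: "homeomorphic_map (geometric_realization K) (real_projective_space 3) \<phi>"
    using tri by (auto simp: triangulates_def homeomorphic_space homeomorphic_map_maps)
  obtain \<kappa> :: "'v \<Rightarrow> nat" where \<kappa>: "\<kappa> ` (\<Union>K) \<subseteq> {1,2,3,4}"
      "\<And>i j. i \<noteq> j \<Longrightarrow> {i, j} \<in> K \<Longrightarrow> \<kappa> i \<noteq> \<kappa> j"
    using bal by (auto simp: balanced3_def)
  define V where "V c = {v \<in> \<Union>K. \<kappa> v = c}" for c
  have four: "4 \<le> card (V c)" if c: "c \<in> {1,2,3,4}" for c
  proof (rule ccontr)
    assume "\<not> 4 \<le> card (V c)"
    moreover have "topspace (geometric_realization K) = (\<Union>v\<in>V c. closed_star v K)"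
    proof
      show "(\<Union>v\<in>V c. closed_star v K) \<subseteq> topspace (geometric_realization K)"
        by (auto simp: closed_star_def)
      show "topspace (geometric_realization K) \<subseteq> (\<Union>v\<in>V c. closed_star v K)"
      proof
        fix x assume x: "x \<in> topspace (geometric_realization K)"
        let ?S = "{u. x u \<noteq> 0}"
        have S: "?S \<in> K" "?S \<noteq> {}"
          using x realization_support_nonempty[OF x] by (auto simp: topspace_realization)
        obtain F where F: "F \<in> K" "?S \<subseteq> F" "\<And>G. G \<in> K \<Longrightarrow> F \<subseteq> G \<Longrightarrow> G = F"
          using finite_has_maximal2[OF finK(1) S(1)] by metis
        have "4 \<le> card F" by (rule maximal_face_card[OF K \<phi> F(1) _ F(3)]) (use F S in auto)
        moreover have "inj_on \<kappa> F"
        proof (rule inj_onI, rule ccontr)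
          fix i j assume ij: "i \<in> F" "j \<in> F" "\<kappa> i = \<kappa> j" "i \<noteq> j"
          then have "{i, j} \<in> K" using finK(3)[OF F(1)] by simp
          then show False using \<kappa>(2) ij by blast
        qed
        ultimately have "4 \<le> card (\<kappa> ` F)" by (simp add: card_image)
        moreover have "\<kappa> ` F \<subseteq> {1,2,3,4}" using \<kappa>(1) F(1) by blast
        ultimately have "\<kappa> ` F = {1,2,3,4}" by (intro card_seteq) auto
        then obtain v where v: "v \<in> F" "\<kappa> v = c" using c by (metis imageE)
        have "insert v ?S \<in> K" using finK(3)[OF F(1)] F(2) v by simp
        then show "x \<in> (\<Union>v\<in>V c. closed_star v K)"
          using x v F(1) by (auto simp: closed_star_def V_def)
      qed
    qed
    moreover have "finite (V c)" unfolding V_def by (rule finite_subset[OF _ finV]) blast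
    moreover have "V c \<subseteq> \<Union>K" unfolding V_def by blast
    ultimately show False
      using three_closed_stars_not_cover[OF K \<phi>, of "V c"] by simp
  qed
  have "\<Union>K = (\<Union>c\<in>{1,2,3,4}. V c)" using \<kappa>(1) by (auto simp: V_def)
  then have "card (\<Union>K) = card (\<Union>c\<in>{1,2,3,4}. V c)" by (rule arg_cong)
  also have "\<dots> = (\<Sum>c\<in>{1,2,3,4}. card (V c))"
  proof (rule card_UN_disjoint)
    have "finite (V c)" for c unfolding V_def by (rule finite_subset[OF _ finV]) blast
    then show "\<forall>c\<in>{1,2,3,4}. finite (V c)" by blast
    show "\<forall>c\<in>{1,2,3,4}. \<forall>d\<in>{1,2,3,4}. c \<noteq> d \<longrightarrow> V c \<inter> V d = {}"
      unfolding V_def by blast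
  qed simp
  also have "\<dots> = card (V 1) + card (V 2) + card (V 3) + card (V 4)" by simp
  finally show ?thesis using four[of 1] four[of 2] four[of 3] four[of 4] by simp
qed


section \<open>Polytopes realizing the two complexes\<close>

text \<open>
  The point \<open>Delta_points ! v\<close> belongs to the vertex \<open>v\<close>; the polytope is the convex hull of these
  points and their negatives.  The coordinates are rounded from a configuration that is invariant
  up to signs under the automorphisms of \<open>Delta\<close>, in which the vertices of each colour form an orthonormal
  frame.
  The frame of \<open>0, 1, 8, 11\<close> is the standard one, scaled by 7, and the entries 3, 4, 5 stand for
  \<open>7 / sqrt 6\<close>, \<open>7 / sqrt 3\<close>, \<open>7 / sqrt 2\<close>.
\<close>
definition Delta_points :: "(int \<times> int \<times> int \<times> int) list" where
  "Delta_points =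
    [(7,0,0,0), (0,7,0,0), (3,-3,3,-5), (4,0,-4,-4), (5,-3,-3,3), (3,3,-5,3),
     (3,-3,3,5), (3,-5,-3,-3), (0,0,7,0), (3,3,5,3), (3,5,-3,-3), (0,0,0,7),
     (5,3,3,-3), (0,4,4,-4), (4,4,0,4), (4,-4,4,0)]"

text \<open>
  For every facet of \<open>Delta\<close> one of the two facets of the polytope above it: an outer normal \<open>n\<close>, the
  height \<open>h\<close> of the supporting hyperplane \<open>n \<bullet> y = h\<close>, and the list of pairs \<open>(v, s)\<close> for which
  \<open>s p\<^sub>v\<close> is a vertex of the facet.
\<close>
definition Delta_facet_data :: "((int \<times> int \<times> int \<times> int) \<times> int \<times> (nat \<times> int) list) list" where
  "Delta_facet_data =
    [((20,-7,-2,-13), 140, [(0,1), (2,1), (3,1), (7,1)]), ((12,-1,0,-9), 84, [(0,1), (2,1), (3,1), (12,1)]),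
     ((20,-13,2,-7), 140, [(0,1), (2,1), (7,1), (15,1)]), ((60,-13,32,-21), 420, [(0,1), (2,1), (12,1), (15,1)]),
     ((12,1,-9,0), 84, [(0,1), (3,1), (4,1), (5,1)]), ((60,-21,-32,-13), 420, [(0,1), (3,1), (4,1), (7,1)]),
     ((20,7,-13,-2), 140, [(0,1), (3,1), (5,1), (10,1)]), ((60,21,-13,-32), 420, [(0,1), (3,1), (10,1), (12,1)]),
     ((60,13,-21,32), 420, [(0,1), (4,1), (5,1), (14,1)]), ((12,0,1,9), 84, [(0,1), (4,1), (6,1), (14,1)]),
     ((60,-32,13,21), 420, [(0,1), (4,1), (6,1), (15,1)]), ((12,-9,0,-1), 84, [(0,1), (4,1), (7,1), (15,1)]),
     ((20,13,-7,2), 140, [(0,1), (5,1), (10,1), (14,1)]), ((20,2,7,13), 140, [(0,1), (6,1), (9,1), (14,1)]),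
     ((20,-2,13,7), 140, [(0,1), (6,1), (9,1), (15,1)]), ((60,32,21,13), 420, [(0,1), (9,1), (12,1), (14,1)]),
     ((12,0,9,1), 84, [(0,1), (9,1), (12,1), (15,1)]), ((12,9,-1,0), 84, [(0,1), (10,1), (12,1), (14,1)]),
     ((2,20,-7,13), 140, [(1,1), (2,-1), (5,1), (14,1)]), ((-2,20,-13,7), 140, [(1,1), (2,-1), (5,1), (15,-1)]),
     ((0,12,-1,9), 84, [(1,1), (2,-1), (7,-1), (14,1)]), ((-32,60,-13,21), 420, [(1,1), (2,-1), (7,-1), (15,-1)]),
     ((-7,20,2,-13), 140, [(1,1), (4,-1), (6,-1), (13,1)]), ((-13,20,-2,-7), 140, [(1,1), (4,-1), (6,-1), (15,-1)]),
     ((-21,60,32,-13), 420, [(1,1), (4,-1), (7,-1), (13,1)]), ((-9,12,0,-1), 84, [(1,1), (4,-1), (7,-1), (15,-1)]),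
     ((32,60,-21,13), 420, [(1,1), (5,1), (10,1), (14,1)]), ((0,12,-9,1), 84, [(1,1), (5,1), (10,1), (15,-1)]),
     ((-1,12,0,-9), 84, [(1,1), (6,-1), (10,1), (13,1)]), ((-13,60,-32,-21), 420, [(1,1), (6,-1), (10,1), (15,-1)]),
     ((1,12,9,0), 84, [(1,1), (7,-1), (9,1), (13,1)]), ((13,60,21,32), 420, [(1,1), (7,-1), (9,1), (14,1)]),
     ((7,20,13,-2), 140, [(1,1), (9,1), (12,1), (13,1)]), ((13,20,7,2), 140, [(1,1), (9,1), (12,1), (14,1)]),
     ((21,60,13,-32), 420, [(1,1), (10,1), (12,1), (13,1)]), ((9,12,1,0), 84, [(1,1), (10,1), (12,1), (14,1)]),
     ((32,-21,-13,-60), 420, [(2,1), (3,1), (7,1), (11,-1)]), ((9,1,0,-12), 84, [(2,1), (3,1), (11,-1), (12,1)]),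
     ((1,0,12,-9), 84, [(2,1), (5,-1), (8,1), (13,1)]), ((13,-32,60,-21), 420, [(2,1), (5,-1), (8,1), (15,1)]),
     ((-1,0,9,-12), 84, [(2,1), (5,-1), (11,-1), (13,1)]), ((-13,-32,21,-60), 420, [(2,1), (5,-1), (11,-1), (14,-1)]),
     ((0,-9,-1,-12), 84, [(2,1), (7,1), (11,-1), (14,-1)]), ((7,2,20,-13), 140, [(2,1), (8,1), (12,1), (13,1)]),
     ((13,-2,20,-7), 140, [(2,1), (8,1), (12,1), (15,1)]), ((21,13,32,-60), 420, [(2,1), (11,-1), (12,1), (13,1)]),
     ((9,-1,-12,0), 84, [(3,1), (4,1), (5,1), (8,-1)]), ((13,-7,-20,-2), 140, [(3,1), (4,1), (7,1), (8,-1)]),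
     ((32,21,-60,-13), 420, [(3,1), (5,1), (8,-1), (10,1)]), ((0,1,-12,-9), 84, [(3,1), (6,-1), (8,-1), (9,-1)]),
     ((2,7,-20,-13), 140, [(3,1), (6,-1), (8,-1), (10,1)]), ((0,-1,-9,-12), 84, [(3,1), (6,-1), (9,-1), (11,-1)]),
     ((13,21,-32,-60), 420, [(3,1), (6,-1), (10,1), (11,-1)]), ((13,-21,-60,-32), 420, [(3,1), (7,1), (8,-1), (9,-1)]),
     ((2,-7,-13,-20), 140, [(3,1), (7,1), (9,-1), (11,-1)]), ((13,7,-2,-20), 140, [(3,1), (10,1), (11,-1), (12,1)]),
     ((21,-13,-60,32), 420, [(4,1), (5,1), (8,-1), (13,-1)]), ((7,-2,-13,20), 140, [(4,1), (5,1), (11,1), (13,-1)]),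
     ((13,2,-7,20), 140, [(4,1), (5,1), (11,1), (14,1)]), ((21,-32,-13,60), 420, [(4,1), (6,1), (11,1), (13,-1)]),
     ((9,0,-1,12), 84, [(4,1), (6,1), (11,1), (14,1)]), ((7,-13,-20,2), 140, [(4,1), (7,1), (8,-1), (13,-1)]),
     ((0,9,-12,-1), 84, [(5,1), (8,-1), (10,1), (15,-1)]), ((32,-13,60,21), 420, [(6,1), (8,1), (9,1), (15,1)]),
     ((2,-13,20,7), 140, [(6,1), (8,1), (10,-1), (15,1)]), ((32,13,21,60), 420, [(6,1), (9,1), (11,1), (14,1)]),
     ((-1,-9,0,12), 84, [(6,1), (10,-1), (11,1), (13,-1)]), ((1,-9,-12,0), 84, [(7,1), (8,-1), (9,-1), (13,-1)]),
     ((-2,-13,-7,-20), 140, [(7,1), (9,-1), (11,-1), (14,-1)]), ((21,32,60,-13), 420, [(8,1), (9,1), (12,1), (13,1)]),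
     ((9,0,12,-1), 84, [(8,1), (9,1), (12,1), (15,1)]), ((7,13,2,-20), 140, [(10,1), (11,-1), (12,1), (13,1)])]"

text \<open>
  The edges \<open>{u, v}\<close> of \<open>Delta\<close> over which the polytope has the edges from \<open>\<plusminus>p\<^sub>u\<close> to \<open>\<minusplus>p\<^sub>v\<close>; over all
  other edges the signs agree.  This is a 1-cocycle modulo 2 that classifies the double cover.
\<close>
definition negative_edges :: "(nat \<times> nat) list" where
  "negative_edges =
    [(1,2), (1,4), (1,6), (1,7), (1,15), (2,5), (2,11), (2,14), (3,6), (3,8),
     (3,9), (3,11), (4,8), (4,13), (5,8), (5,13), (5,15), (6,10), (6,13), (7,8),
     (7,9), (7,11), (7,13), (7,14), (8,10), (10,11), (10,15), (11,12), (11,13)]"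

text \<open>
  The coordinates are rounded from a rotated vertex figure of the polytope above at the vertex \<open>0\<close>, since
  \<open>L_sphere\<close> is the link of this vertex.
\<close>
definition L_points :: "(nat \<times> int \<times> int \<times> int) list" where
  "L_points =
    [(2,0,1,1), (3,1,2,0), (4,2,-1,0), (5,1,0,-1), (6,0,-2,0), (7,1,1,1),
     (9,-1,-1,0), (10,0,1,-1), (12,-2,1,0), (14,-1,-1,-2), (15,0,-1,2)]"

definition L_facet_data :: "((int \<times> int \<times> int) \<times> int \<times> nat list) list" where
  "L_facet_data =
    [((0,1,1), 2, [2, 3, 7]), ((-1,3,2), 5, [2, 3, 12]), ((0,1,2), 3, [2, 7, 15]),
     ((-1,1,2), 3, [2, 12, 15]), ((3,1,-2), 5, [3, 4, 5]), ((3,1,1), 5, [3, 4, 7]),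
     ((1,1,-2), 3, [3, 5, 10]), ((-1,3,-2), 5, [3, 10, 12]), ((2,-1,-3), 5, [4, 5, 14]),
     ((2,-4,-3), 8, [4, 6, 14]), ((1,-2,1), 4, [4, 6, 15]), ((1,0,1), 2, [4, 7, 15]),
     ((1,1,-3), 4, [5, 10, 14]), ((-1,-1,0), 2, [6, 9, 14]), ((-2,-2,1), 4, [6, 9, 15]),
     ((-2,-1,0), 3, [9, 12, 14]), ((-2,-1,1), 3, [9, 12, 15]), ((-2,3,-4), 7, [10, 12, 14])]"

text \<open>
  The entry \<open>Delta_neighbours ! i ! k\<close> is the position in \<open>Delta_facet_data\<close> of the facet that shares
  with the facet \<open>i\<close> all vertices except for the \<open>k\<close>-th.
\<close>
definition Delta_neighbours :: "nat list list" where
  "Delta_neighbours =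
    [[36, 5, 2, 1], [37, 7, 3, 0], [21, 11, 3, 0], [44, 16, 2, 1], [46, 8, 6, 5],
     [47, 11, 0, 4], [48, 12, 7, 4], [55, 17, 1, 6], [58, 12, 9, 4], [60, 13, 8, 10],
     [23, 14, 11, 9], [25, 2, 10, 5], [26, 17, 8, 6], [65, 15, 9, 14], [63, 16, 10, 13],
     [33, 17, 13, 16], [70, 3, 14, 15], [35, 15, 12, 7], [41, 26, 20, 19], [39, 27, 21, 18],
     [42, 31, 18, 21], [2, 25, 19, 20], [59, 28, 24, 23], [10, 29, 25, 22], [61, 30, 22, 25],
     [11, 21, 23, 24], [12, 35, 18, 27], [62, 29, 19, 26], [66, 34, 22, 29], [64, 27, 23, 28],
     [67, 32, 24, 31], [68, 33, 20, 30], [69, 34, 30, 33], [15, 35, 31, 32], [71, 32, 28, 35],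
     [17, 33, 26, 34], [54, 42, 37, 0], [55, 45, 1, 36], [56, 43, 40, 39], [62, 44, 19, 38],
     [57, 45, 38, 41], [58, 42, 18, 40], [68, 41, 20, 36], [69, 45, 38, 44], [70, 3, 39, 43],
     [71, 43, 40, 37], [56, 48, 47, 4], [61, 53, 46, 5], [62, 50, 6, 46], [63, 53, 51, 50],
     [64, 48, 52, 49], [65, 54, 52, 49], [66, 55, 51, 50], [67, 49, 54, 47], [68, 51, 36, 53],
     [71, 37, 7, 52], [38, 61, 57, 46], [40, 59, 56, 58], [41, 60, 8, 57], [66, 57, 22, 60],
     [65, 58, 9, 59], [67, 56, 24, 47], [64, 27, 39, 48], [70, 14, 64, 49], [62, 29, 63, 50],
     [68, 60, 13, 51], [71, 59, 28, 52], [69, 30, 61, 53], [65, 42, 31, 54], [32, 43, 67, 70],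
     [16, 44, 63, 69], [45, 34, 66, 55]]"

text \<open>
  The list \<open>link_maps ! v\<close> is an automorphism of \<open>Delta\<close>, written as a permutation of the vertices, that
  sends \<open>v\<close> to \<open>0\<close>.
\<close>
definition link_maps :: "nat list list" where
  "link_maps =
    [[0, 1, 2, 3, 4, 5, 6, 7, 8, 9, 10, 11, 12, 13, 14, 15],
     [1, 0, 6, 13, 7, 9, 2, 4, 8, 5, 12, 11, 10, 3, 14, 15],
     [2, 10, 0, 7, 11, 14, 13, 3, 9, 8, 1, 4, 15, 6, 5, 12],
     [3, 13, 2, 0, 10, 5, 6, 12, 14, 9, 4, 15, 7, 1, 8, 11],
     [4, 2, 1, 6, 0, 14, 3, 15, 9, 8, 11, 10, 13, 12, 5, 7],
     [2, 10, 14, 7, 15, 0, 8, 1, 4, 13, 3, 9, 11, 6, 12, 5],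
     [6, 7, 13, 10, 15, 8, 0, 1, 5, 14, 3, 12, 11, 2, 9, 4],
     [2, 4, 3, 12, 15, 8, 1, 0, 9, 14, 13, 10, 11, 6, 5, 7],
     [1, 8, 2, 14, 10, 12, 6, 5, 0, 4, 9, 11, 7, 3, 13, 15],
     [2, 9, 1, 5, 11, 13, 3, 14, 4, 0, 8, 10, 15, 6, 12, 7],
     [6, 12, 1, 4, 11, 14, 3, 13, 5, 8, 0, 7, 15, 2, 9, 10],
     [1, 11, 4, 15, 10, 5, 12, 6, 8, 9, 2, 0, 7, 3, 14, 13],
     [4, 10, 15, 7, 13, 8, 11, 1, 9, 14, 3, 2, 0, 12, 5, 6],
     [13, 3, 6, 1, 12, 9, 2, 10, 14, 5, 7, 15, 4, 0, 8, 11],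
     [14, 3, 2, 1, 9, 12, 6, 7, 13, 4, 10, 15, 5, 8, 0, 11],
     [15, 3, 4, 1, 2, 5, 12, 7, 14, 9, 10, 13, 6, 11, 8, 0]]"

definition antipode_list :: "nat list" where
  "antipode_list = [13, 3, 6, 1, 12, 9, 2, 10, 14, 5, 7, 15, 4, 0, 8, 11]"

definition colouring :: "nat list" where
  "colouring = [1, 1, 2, 3, 2, 4, 4, 4, 1, 2, 2, 1, 4, 3, 3, 3]"

fun dot4 :: "int \<times> int \<times> int \<times> int \<Rightarrow> int \<times> int \<times> int \<times> int \<Rightarrow> int" where
  "dot4 (a, b, c, d) (a', b', c', d') = a * a' + b * b' + c * c' + d * d'"

fun dot3 :: "int \<times> int \<times> int \<Rightarrow> int \<times> int \<times> int \<Rightarrow> int" where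
  "dot3 (a, b, c) (a', b', c') = a * a' + b * b' + c * c'"

definition Delta_list :: "nat list list" where
  "Delta_list = map (\<lambda>r. map fst (snd (snd r))) Delta_facet_data"

lemma Delta_facets_list: "Delta_facets = set ` set Delta_list"
  unfolding Delta_facets_def Delta_list_def Delta_facet_data_def
  by (simp only: list.map list.set fst_conv snd_conv image_insert image_empty)

lemma L_triangles_list: "L_triangles = set ` set (map (snd \<circ> snd) L_facet_data)"
  unfolding L_triangles_def L_facet_data_def
  by (simp only: list.map list.set fst_conv snd_conv image_insert image_empty o_apply)

lemma Delta_facet_data_supporting:
  "\<forall>r\<in>set Delta_facet_data. 0 < fst (snd r) \<and> length (snd (snd r)) = 4 \<and> distinct (map fst (snd (snd r))) \<and>
     (\<forall>v\<in>{0..<16}. case map_of (snd (snd r)) v of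
         None \<Rightarrow> \<bar>dot4 (fst r) (Delta_points ! v)\<bar> < fst (snd r)
       | Some s \<Rightarrow> (s = 1 \<or> s = - 1) \<and> dot4 (fst r) (Delta_points ! v) = s * fst (snd r))"
  by code_simp

text \<open>
  The signs of the end points of an edge agree or differ independently of the facet that contains
  the edge.  This makes the map that forgets the signs exactly two-to-one.
\<close>
lemma Delta_facet_data_edges:
  "\<forall>r\<in>set Delta_facet_data. \<forall>x\<in>set (snd (snd r)). \<forall>y\<in>set (snd (snd r)). fst x < fst y \<longrightarrow>
     snd x * snd y = (if (fst x, fst y) \<in> set negative_edges then - 1 else 1)"
  by code_simp

lemma Delta_facet_data_ridges:
  "length Delta_neighbours = length Delta_facet_data"
  "\<forall>(r, ks)\<in>set (zip Delta_facet_data Delta_neighbours). length ks = 4 \<and> (\<forall>(x, k)\<in>set (zip (snd (snd r)) ks).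
     k < 72 \<and> fst x \<notin> set (map fst (snd (snd (Delta_facet_data ! k)))) \<and>
     ((\<forall>y\<in>set (snd (snd r)). y = x \<or> y \<in> set (snd (snd (Delta_facet_data ! k)))) \<or>
      (\<forall>y\<in>set (snd (snd r)). y = x \<or> (fst y, - snd y) \<in> set (snd (snd (Delta_facet_data ! k))))))"
  by code_simp+

lemma L_facet_data_supporting:
  "\<forall>r\<in>set L_facet_data. 0 < fst (snd r) \<and> length (snd (snd r)) = 3 \<and> distinct (snd (snd r)) \<and>
     (\<forall>x\<in>set L_points. if fst x \<in> set (snd (snd r)) then dot3 (fst r) (snd x) = fst (snd r)
        else dot3 (fst r) (snd x) < fst (snd r)) \<and>
     (\<forall>v\<in>set (snd (snd r)). \<exists>r'\<in>set L_facet_data. v \<notin> set (snd (snd r')) \<and>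
        (\<forall>w\<in>set (snd (snd r)). w = v \<or> w \<in> set (snd (snd r'))))"
  by code_simp

lemma L_points_vertices:
  "distinct (map fst L_points)"
  "set (map fst L_points) = {2,3,4,5,6,7,9,10,12,14,15}"
  "set (concat (map (\<lambda>r. snd (snd r)) L_facet_data)) = {2,3,4,5,6,7,9,10,12,14,15}"
  by code_simp+

lemma Delta_list_facets:
  "length Delta_list = 72" "distinct Delta_list" "set (concat Delta_list) = {0..15}"
  "\<forall>F\<in>set Delta_list. length F = 4 \<and> sorted F \<and> distinct F"
  by code_simp+

lemma L_facet_data_triangles:
  "length (map (snd \<circ> snd) L_facet_data) = 18" "distinct (map (snd \<circ> snd) L_facet_data)"
  "\<forall>F\<in>set (map (snd \<circ> snd) L_facet_data). sorted F \<and> distinct F"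
  by code_simp+

lemma colouring_proper:
  "\<forall>F\<in>set Delta_list. distinct (map ((!) colouring) F)" "set colouring = {1,2,3,4}" "length colouring = 16"
  by code_simp+

lemma antipode_list_free:
  "\<forall>F\<in>set Delta_list. sort (map ((!) antipode_list) F) \<in> set Delta_list \<and> (\<forall>v\<in>set F. antipode_list ! v \<notin> set F)"
  "\<forall>v\<in>{0..<16}. antipode_list ! v < 16 \<and> antipode_list ! (antipode_list ! v) = v"
  by code_simp+

lemma link_maps_isomorphic:
  "\<forall>v\<in>{0..<16}. distinct (link_maps ! v) \<and> length (link_maps ! v) = 16 \<and>
     set (map (\<lambda>F. sort (map ((!) (link_maps ! v)) (remove1 v F))) (filter (\<lambda>F. v \<in> set F) Delta_list))
       = set (map (snd \<circ> snd) L_facet_data)"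
  by code_simp


section \<open>Realizing the sphere\<close>

fun vec3 :: "int \<times> int \<times> int \<Rightarrow> real \<times> real \<times> real" where
  "vec3 (a, b, c) = (of_int a, of_int b, of_int c)"

fun vec4 :: "int \<times> int \<times> int \<times> int \<Rightarrow> real \<times> real \<times> real \<times> real" where
  "vec4 (a, b, c, d) = (of_int a, of_int b, of_int c, of_int d)"

lemma inner_vec3: "vec3 x \<bullet> vec3 y = of_int (dot3 x y)"
  by (cases x; cases y) simp

lemma inner_vec4: "vec4 x \<bullet> vec4 y = of_int (dot4 x y)"
  by (cases x; cases y) simp

theorem triangulates_L_sphere: "triangulates L_sphere (nsphere 2)"
proof -
  define Fc :: "(int \<times> int \<times> int) \<times> int \<times> nat list \<Rightarrow> nat set" where "Fc r = set (snd (snd r))" for r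
  define p where "p v = vec3 (the (map_of L_points v))" for v
  define N where "N r = (1 / of_int (fst (snd r))) *\<^sub>R vec3 (fst r)"
    for r :: "(int \<times> int \<times> int) \<times> int \<times> nat list"
  note supp = L_facet_data_supporting[rule_format]
  have NP: "N r \<bullet> p v = of_int (dot3 (fst r) (the (map_of L_points v))) / of_int (fst (snd r))" for r v
    by (simp add: N_def p_def inner_vec3)
  have pt: "(v, the (map_of L_points v)) \<in> set L_points" if "r \<in> set L_facet_data" "v \<in> Fc r" for r v
  proof -
    have "v \<in> set (concat (map (\<lambda>r. snd (snd r)) L_facet_data))" using that by (auto simp: Fc_def)
    then have "v \<in> fst ` set L_points" unfolding L_points_vertices(3) L_points_vertices(2)[symmetric] by simp
    then obtain w where "(v, w) \<in> set L_points" by auto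
    then show ?thesis using map_of_eq_Some_iff[OF L_points_vertices(1)] by (metis option.sel)
  qed
  have "homeomorphic_map (geometric_realization (generated_complex (Fc ` set L_facet_data))) (top_of_set (sphere 0 1))
     (\<lambda>x. sgn (\<Sum>v\<in>(\<Union>i\<in>set L_facet_data. Fc i). x v *\<^sub>R p v))"
  proof (rule polytopal_sphere[where N = N])
    show "set L_facet_data \<noteq> {}" by (simp add: L_facet_data_def)
    show "finite (Fc i)" for i by (simp add: Fc_def)
    show "card (Fc i) = DIM(real \<times> real \<times> real)" if "i \<in> set L_facet_data" for i
      using supp[OF that] by (simp add: Fc_def distinct_card)
    show "N i \<bullet> p v = 1" if "i \<in> set L_facet_data" "v \<in> Fc i" for i v
      using conjunct1[OF conjunct2[OF conjunct2[OF conjunct2[OF supp[OF that(1)]]]], rule_format, OF pt[OF that]]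
        supp[OF that(1)] that by (simp add: NP Fc_def)
    show "N i \<bullet> p v < 1" if "i \<in> set L_facet_data" "j \<in> set L_facet_data" "v \<in> Fc j" "v \<notin> Fc i" for i j v
      using conjunct1[OF conjunct2[OF conjunct2[OF conjunct2[OF supp[OF that(1)]]]], rule_format, OF pt[OF that(2,3)]]
        supp[OF that(1)] that by (simp add: NP Fc_def)
    show "\<exists>j\<in>set L_facet_data. Fc i - {v} \<subseteq> Fc j \<and> v \<notin> Fc j" if "i \<in> set L_facet_data" "v \<in> Fc i" for i v
      using supp[OF that(1)] that(2) unfolding Fc_def by blast
  qed simp
  moreover have "generated_complex (Fc ` set L_facet_data) = L_sphere"
    unfolding L_sphere_def L_triangles_list by (simp add: Fc_def image_image)
  ultimately have "geometric_realization L_sphere homeomorphic_space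
      top_of_set (sphere (0 :: real \<times> real \<times> real) 1)"
    using homeomorphic_map_imp_homeomorphic_space by fastforce
  moreover have "top_of_set (sphere (0 :: real \<times> real \<times> real) 1) homeomorphic_space nsphere 2"
    using sphere_homeomorphic_nsphere2 homeomorphic_space_def by blast
  moreover have "finite_simplicial_complex L_sphere"
    unfolding L_sphere_def L_triangles_list
    by (rule finite_simplicial_complex_generated) auto
  ultimately show ?thesis
    using homeomorphic_space_trans by (auto simp: triangulates_def)
qed


section \<open>Realizing projective space\<close>

text \<open>
  This is applied to the 3-sphere above both \<open>Delta\<close> and projective space, so that no map between these
  two spaces has to be written down.
\<close>
lemma quotient_maps_same_fibres_homeomorphic:
  assumes f: "quotient_map X Y f" and g: "quotient_map X Z g"
    and fibres: "\<And>x x'. x \<in> topspace X \<Longrightarrow> x' \<in> topspace X \<Longrightarrow> f x = f x' \<longleftrightarrow> g x = g x'"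
  shows "Y homeomorphic_space Z"
proof -
  obtain h where h: "continuous_map Y Z h" "\<And>x. x \<in> topspace X \<Longrightarrow> h (f x) = g x"
    using quotient_map_lift_exists[OF f quotient_imp_continuous_map[OF g]] fibres by metis
  obtain k where k: "continuous_map Z Y k" "\<And>x. x \<in> topspace X \<Longrightarrow> k (g x) = f x"
    using quotient_map_lift_exists[OF g quotient_imp_continuous_map[OF f]] fibres by metis
  have "f ` topspace X = topspace Y" "g ` topspace X = topspace Z"
    using f g by (auto simp: quotient_map_def)
  then have "k (h y) = y" if "y \<in> topspace Y" for y
    using h(2) k(2) that by (metis imageE)
  moreover have "h (k z) = z" if "z \<in> topspace Z" for z
    using \<open>g ` topspace X = topspace Z\<close> h(2) k(2) that by (metis imageE)
  ultimately have "homeomorphic_maps Y Z h k"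
    using h(1) k(1) by (simp add: homeomorphic_maps_def)
  then show ?thesis by (auto simp: homeomorphic_space_def)
qed

type_synonym facet_datum = "(int \<times> int \<times> int \<times> int) \<times> int \<times> (nat \<times> int) list"

definition facet_sign :: "facet_datum \<Rightarrow> nat \<Rightarrow> int" where
  "facet_sign r v = the (map_of (snd (snd r)) v)"

definition facet_vertices :: "facet_datum \<Rightarrow> nat set" where
  "facet_vertices r = fst ` set (snd (snd r))"

text \<open>
  The facets of the polytope, as sets of signed vertices: an index consists of a facet of \<open>Delta\<close> and
  of a sign that exchanges the two antipodal facets above it.
\<close>
definition signed_facet :: "facet_datum \<times> int \<Rightarrow> (nat \<times> int) set" where
  "signed_facet i = {(v, t). v \<in> facet_vertices (fst i) \<and> t = snd i * facet_sign (fst i) v}"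

definition signed_index :: "(facet_datum \<times> int) set" where
  "signed_index = set Delta_facet_data \<times> {1, - 1}"

definition signed_point :: "nat \<times> int \<Rightarrow> real \<times> real \<times> real \<times> real" where
  "signed_point w = of_int (snd w) *\<^sub>R vec4 (Delta_points ! fst w)"

definition signed_normal :: "facet_datum \<times> int \<Rightarrow> real \<times> real \<times> real \<times> real" where
  "signed_normal i = (of_int (snd i) / of_int (fst (snd (fst i)))) *\<^sub>R vec4 (fst (fst i))"

definition Delta_cover :: "(nat \<times> int) set set" where
  "Delta_cover = generated_complex (signed_facet ` signed_index)"

lemma Delta_facets_eq_facet_vertices: "Delta_facets = facet_vertices ` set Delta_facet_data"
  unfolding Delta_facets_list Delta_list_def facet_vertices_def by (simp add: image_image)

lemma finite_facet_vertices: "finite (facet_vertices r)"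
  by (simp add: facet_vertices_def)

lemma facet_data_lookup:
  assumes "r \<in> set Delta_facet_data"
  shows "(v, s) \<in> set (snd (snd r)) \<longleftrightarrow> v \<in> facet_vertices r \<and> s = facet_sign r v"
proof -
  have d: "distinct (map fst (snd (snd r)))" using Delta_facet_data_supporting assms by blast
  then show ?thesis
    unfolding facet_vertices_def facet_sign_def
    by (metis (no_types, lifting) fst_conv image_iff map_of_eq_Some_iff option.sel prod.collapse)
qed

lemma facet_vertices_lt:
  assumes "r \<in> set Delta_facet_data" "v \<in> facet_vertices r"
  shows "v < 16"
proof -
  have "v \<in> set (concat Delta_list)"
    using assms by (auto simp: facet_vertices_def Delta_list_def)
  then show ?thesis unfolding Delta_list_facets(3) by simp
qed

lemma facet_data_on:
  assumes "r \<in> set Delta_facet_data" "v \<in> facet_vertices r"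
  shows "facet_sign r v = 1 \<or> facet_sign r v = - 1"
    "dot4 (fst r) (Delta_points ! v) = facet_sign r v * fst (snd r)"
proof -
  obtain s where s: "map_of (snd (snd r)) v = Some s"
    using assms(2) by (metis map_of_eq_None_iff not_None_eq facet_vertices_def)
  have "v \<in> {0..<16}" using facet_vertices_lt[OF assms] by simp
  then have "case map_of (snd (snd r)) v of
         None \<Rightarrow> \<bar>dot4 (fst r) (Delta_points ! v)\<bar> < fst (snd r)
       | Some s \<Rightarrow> (s = 1 \<or> s = - 1) \<and> dot4 (fst r) (Delta_points ! v) = s * fst (snd r)"
    using Delta_facet_data_supporting assms(1) by blast
  then show "facet_sign r v = 1 \<or> facet_sign r v = - 1"
    "dot4 (fst r) (Delta_points ! v) = facet_sign r v * fst (snd r)"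
    using s by (simp_all add: facet_sign_def)
qed

lemma facet_data_off:
  assumes "r \<in> set Delta_facet_data" "v \<notin> facet_vertices r" "v < 16"
  shows "\<bar>dot4 (fst r) (Delta_points ! v)\<bar> < fst (snd r)"
proof -
  have s: "map_of (snd (snd r)) v = None"
    using assms(2) by (simp add: map_of_eq_None_iff facet_vertices_def)
  have "v \<in> {0..<16}" using assms by simp
  then have "case map_of (snd (snd r)) v of
         None \<Rightarrow> \<bar>dot4 (fst r) (Delta_points ! v)\<bar> < fst (snd r)
       | Some s \<Rightarrow> (s = 1 \<or> s = - 1) \<and> dot4 (fst r) (Delta_points ! v) = s * fst (snd r)"
    using Delta_facet_data_supporting assms(1) by blast
  then show ?thesis using s by simp
qed

lemma facet_data_height: "r \<in> set Delta_facet_data \<Longrightarrow> 0 < fst (snd r)"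
  using Delta_facet_data_supporting by blast

lemma card_facet_vertices:
  assumes "r \<in> set Delta_facet_data"
  shows "card (facet_vertices r) = 4"
proof -
  have "distinct (map fst (snd (snd r)))" "length (snd (snd r)) = 4" using Delta_facet_data_supporting assms by blast+
  then show ?thesis using distinct_card[of "map fst (snd (snd r))"] by (simp add: facet_vertices_def)
qed

lemma ridge_neighbour:
  assumes "r \<in> set Delta_facet_data" "x \<in> set (snd (snd r))"
  shows "\<exists>r'\<in>set Delta_facet_data. fst x \<notin> facet_vertices r' \<and>
     ((\<forall>y\<in>set (snd (snd r)). y = x \<or> y \<in> set (snd (snd r'))) \<or>
      (\<forall>y\<in>set (snd (snd r)). y = x \<or> (fst y, - snd y) \<in> set (snd (snd r'))))"
proof -
  have len: "length Delta_facet_data = 72" using Delta_list_facets(1) by (simp add: Delta_list_def)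
  obtain i where i: "i < length Delta_facet_data" "r = Delta_facet_data ! i"
    using assms(1) by (metis in_set_conv_nth)
  define ks where "ks = Delta_neighbours ! i"
  have "(r, ks) \<in> set (zip Delta_facet_data Delta_neighbours)"
    unfolding set_zip using i Delta_facet_data_ridges(1) by (auto simp: ks_def)
  note chk = bspec[OF Delta_facet_data_ridges(2) this, unfolded prod.case]
  have "length (snd (snd r)) = 4" using Delta_facet_data_supporting assms(1) by blast
  moreover have "length ks = 4" using chk by (rule conjunct1)
  moreover obtain j where "j < length (snd (snd r))" "x = snd (snd r) ! j"
    using assms(2) by (metis in_set_conv_nth)
  ultimately have "(x, ks ! j) \<in> set (zip (snd (snd r)) ks)"
    unfolding set_zip by auto
  note k = bspec[OF conjunct2[OF chk] this, unfolded prod.case]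
  show ?thesis
  proof (rule bexI)
    show "Delta_facet_data ! (ks ! j) \<in> set Delta_facet_data" using k len by (intro nth_mem) simp
    show "fst x \<notin> facet_vertices (Delta_facet_data ! (ks ! j)) \<and>
     ((\<forall>y\<in>set (snd (snd r)). y = x \<or> y \<in> set (snd (snd (Delta_facet_data ! (ks ! j))))) \<or>
      (\<forall>y\<in>set (snd (snd r)). y = x \<or> (fst y, - snd y) \<in> set (snd (snd (Delta_facet_data ! (ks ! j))))))"
      using k unfolding facet_vertices_def set_map by (rule conjunct2)
  qed
qed

lemma Delta_cover_homeomorphic_sphere:
  "homeomorphic_map (geometric_realization Delta_cover) (top_of_set (sphere 0 1))
     (\<lambda>x. sgn (\<Sum>w\<in>(\<Union>i\<in>signed_index. signed_facet i). x w *\<^sub>R signed_point w))"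
  unfolding Delta_cover_def
proof (rule polytopal_sphere[where N = signed_normal])
  show "finite signed_index" by (simp add: signed_index_def)
  show "signed_index \<noteq> {}" by (simp add: signed_index_def Delta_facet_data_def)
  have eq: "signed_facet i = (\<lambda>v. (v, snd i * facet_sign (fst i) v)) ` facet_vertices (fst i)" for i
    by (auto simp: signed_facet_def)
  show "finite (signed_facet i)" for i by (simp add: eq finite_facet_vertices)
  show "card (signed_facet i) = DIM(real \<times> real \<times> real \<times> real)" if "i \<in> signed_index" for i
    unfolding eq using that by (subst card_image) (auto simp: inj_on_def signed_index_def card_facet_vertices)
  have NP: "signed_normal (r, e) \<bullet> signed_point (v, t) =
      of_int (e * t * dot4 (fst r) (Delta_points ! v)) / of_int (fst (snd r))" for r e v t
    by (simp add: signed_normal_def signed_point_def inner_vec4)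
  show "signed_normal i \<bullet> signed_point w = 1" if "i \<in> signed_index" "w \<in> signed_facet i" for i w
  proof -
    obtain r e v t where [simp]: "i = (r, e)" "w = (v, t)" by (metis surj_pair)
    have r: "r \<in> set Delta_facet_data" "e = 1 \<or> e = - 1" "v \<in> facet_vertices r" "t = e * facet_sign r v"
      using that by (auto simp: signed_index_def signed_facet_def)
    then show ?thesis
      using facet_data_on[OF r(1,3)] facet_data_height[OF r(1)] by (auto simp: NP)
  qed
  show "signed_normal i \<bullet> signed_point w < 1"
    if "i \<in> signed_index" "j \<in> signed_index" "w \<in> signed_facet j" "w \<notin> signed_facet i" for i j w
  proof -
    obtain r e v t where [simp]: "i = (r, e)" "w = (v, t)" by (metis surj_pair)
    have r: "r \<in> set Delta_facet_data" "e = 1 \<or> e = - 1"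
      using that by (auto simp: signed_index_def)
    have t: "t = 1 \<or> t = - 1" and v: "v < 16"
    proof -
      obtain r' e' where [simp]: "j = (r', e')" by (metis surj_pair)
      have r': "r' \<in> set Delta_facet_data" "e' = 1 \<or> e' = - 1" "v \<in> facet_vertices r'" "t = e' * facet_sign r' v"
        using that(2,3) by (auto simp: signed_index_def signed_facet_def)
      show "v < 16" using facet_vertices_lt r'(1,3) by blast
      show "t = 1 \<or> t = - 1" using facet_data_on(1)[OF r'(1,3)] r'(2,4) by auto
    qed
    show ?thesis
    proof (cases "v \<in> facet_vertices r")
      case True
      then have "t \<noteq> e * facet_sign r v" using that(4) by (simp add: signed_facet_def)
      then have "t = - (e * facet_sign r v)" using t r(2) facet_data_on(1)[OF r(1) True] by auto
      then show ?thesis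
        using r(2) facet_data_on[OF r(1) True] facet_data_height[OF r(1)] by (auto simp: NP)
    next
      case False
      have "e * t * dot4 (fst r) (Delta_points ! v) \<le> \<bar>dot4 (fst r) (Delta_points ! v)\<bar>"
        using r(2) t by auto
      then have "e * t * dot4 (fst r) (Delta_points ! v) < fst (snd r)"
        using facet_data_off[OF r(1) False v] by linarith
      then show ?thesis using facet_data_height[OF r(1)]
        by (simp only: \<open>i = (r, e)\<close> \<open>w = (v, t)\<close> NP) (simp add: divide_less_eq_1 del: of_int_mult)
    qed
  qed
  show "\<exists>j\<in>signed_index. signed_facet i - {w} \<subseteq> signed_facet j \<and> w \<notin> signed_facet j"
    if "i \<in> signed_index" "w \<in> signed_facet i" for i w
  proof -
    obtain r e v t where [simp]: "i = (r, e)" "w = (v, t)" by (metis surj_pair)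
    have r: "r \<in> set Delta_facet_data" "e = 1 \<or> e = - 1" "v \<in> facet_vertices r" "t = e * facet_sign r v"
      using that by (auto simp: signed_index_def signed_facet_def)
    let ?x = "(v, facet_sign r v)"
    have "?x \<in> set (snd (snd r))" using r facet_data_lookup by blast
    then obtain r' where r': "r' \<in> set Delta_facet_data" "v \<notin> facet_vertices r'"
      "(\<forall>y\<in>set (snd (snd r)). y = ?x \<or> y \<in> set (snd (snd r'))) \<or>
       (\<forall>y\<in>set (snd (snd r)). y = ?x \<or> (fst y, - snd y) \<in> set (snd (snd r')))"
      using ridge_neighbour[OF r(1), of ?x] by auto
    from r'(3) obtain d where d: "d = 1 \<or> d = - 1"
      "\<And>u. u \<in> facet_vertices r \<Longrightarrow> u \<noteq> v \<Longrightarrow> (u, d * facet_sign r u) \<in> set (snd (snd r'))"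
    proof (elim disjE)
      assume *: "\<forall>y\<in>set (snd (snd r)). y = ?x \<or> y \<in> set (snd (snd r'))"
      show ?thesis
        by (rule that[of 1]) (use * facet_data_lookup[OF r(1)] in auto)
    next
      assume *: "\<forall>y\<in>set (snd (snd r)). y = ?x \<or> (fst y, - snd y) \<in> set (snd (snd r'))"
      show ?thesis
        by (rule that[of "- 1"]) (use * facet_data_lookup[OF r(1)] in force)+
    qed
    have d': "u \<in> facet_vertices r' \<and> facet_sign r' u = d * facet_sign r u" if "u \<in> facet_vertices r" "u \<noteq> v" for u
      using d(2)[OF that] facet_data_lookup[OF r'(1)] by simp
    have "signed_facet i - {w} \<subseteq> signed_facet (r', d * e)"
    proof
      fix y assume y: "y \<in> signed_facet i - {w}"
      obtain u s where [simp]: "y = (u, s)" by (metis surj_pair)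
      have u: "u \<in> facet_vertices r" "s = e * facet_sign r u" using y by (auto simp: signed_facet_def)
      then have "u \<noteq> v" using y r(4) by auto
      then show "y \<in> signed_facet (r', d * e)"
        using d'[OF u(1)] u d(1) by (auto simp: signed_facet_def)
    qed
    moreover have "(r', d * e) \<in> signed_index" using r' r d(1) by (auto simp: signed_index_def)
    moreover have "w \<notin> signed_facet (r', d * e)" using r'(2) by (simp add: signed_facet_def)
    ultimately show ?thesis by blast
  qed
qed

lemma edge_sign_unique:
  assumes r: "r \<in> set Delta_facet_data" "u \<in> facet_vertices r" "v \<in> facet_vertices r"
    and r': "r' \<in> set Delta_facet_data" "u \<in> facet_vertices r'" "v \<in> facet_vertices r'"
  shows "facet_sign r u * facet_sign r v = facet_sign r' u * facet_sign r' v"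
proof -
  have lt: "facet_sign r u * facet_sign r v = (if (u, v) \<in> set negative_edges then - 1 else 1)"
    if "r \<in> set Delta_facet_data" "u \<in> facet_vertices r" "v \<in> facet_vertices r" "u < v" for r u v
  proof -
    have "(u, facet_sign r u) \<in> set (snd (snd r))" "(v, facet_sign r v) \<in> set (snd (snd r))"
      using that facet_data_lookup by blast+
    then show ?thesis
      using Delta_facet_data_edges that(1,4) by (metis fst_conv snd_conv)
  qed
  consider "u < v" | "u = v" | "v < u" by linarith
  then show ?thesis
  proof cases
    case 1 then show ?thesis using lt r r' by simp
  next
    case 2 then show ?thesis using facet_data_on(1)[OF r(1,2)] facet_data_on(1)[OF r'(1,2)] by auto
  next
    case 3 then show ?thesis using lt[of r v u] lt[of r' v u] r r' by (simp add: mult.commute)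
  qed
qed

definition forget_sign :: "(nat \<times> int \<Rightarrow> real) \<Rightarrow> nat \<Rightarrow> real" where
  "forget_sign x v = x (v, 1) + x (v, - 1)"

definition flip :: "(nat \<times> int \<Rightarrow> real) \<Rightarrow> nat \<times> int \<Rightarrow> real" where
  "flip x w = x (fst w, - snd w)"

lemma cover_support:
  assumes "x \<in> topspace (geometric_realization Delta_cover)"
  obtains r e where "r \<in> set Delta_facet_data" "e = 1 \<or> e = - 1" "{w. x w \<noteq> 0} \<subseteq> signed_facet (r, e)"
proof -
  have "{w. x w \<noteq> 0} \<in> Delta_cover" using assms by (simp add: topspace_realization)
  then obtain i where i: "i \<in> signed_index" "{w. x w \<noteq> 0} \<subseteq> signed_facet i"
    unfolding Delta_cover_def generated_complex_def by blast
  obtain r e where "i = (r, e)" by (metis surj_pair)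
  with i show ?thesis using that[of r e] by (auto simp: signed_index_def)
qed

lemma forget_sign_supported:
  assumes r: "r \<in> set Delta_facet_data" "e = 1 \<or> e = - 1" and x: "{w. x w \<noteq> 0} \<subseteq> signed_facet (r, e)"
  shows "forget_sign x v = (if v \<in> facet_vertices r then x (v, e * facet_sign r v) else 0)"
    and "x (v, t) = (if v \<in> facet_vertices r \<and> t = e * facet_sign r v then forget_sign x v else 0)"
proof -
  have z: "x (v, t) = 0" if "\<not> (v \<in> facet_vertices r \<and> t = e * facet_sign r v)" for v t
    using x that by (auto simp: signed_facet_def)
  show *: "forget_sign x v = (if v \<in> facet_vertices r then x (v, e * facet_sign r v) else 0)" for v
  proof (cases "v \<in> facet_vertices r")
    case True
    then have "e * facet_sign r v = 1 \<or> e * facet_sign r v = - 1" using facet_data_on(1)[OF r(1) True] r(2) by auto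
    then show ?thesis using z[of v 1] z[of v "- 1"] True by (auto simp: forget_sign_def)
  next
    case False
    then show ?thesis using z[of v] by (simp add: forget_sign_def)
  qed
  show "x (v, t) = (if v \<in> facet_vertices r \<and> t = e * facet_sign r v then forget_sign x v else 0)"
    using z *[of v] by auto
qed

text \<open>
  The supports of two points with equal images lie over the same face of \<open>Delta\<close>.  The products of
  the signs of two vertices are determined by this face, so the signs of the two supports are equal
  throughout or opposite throughout.
\<close>
lemma forget_sign_fibre:
  assumes x: "x \<in> topspace (geometric_realization Delta_cover)"
    and y: "y \<in> topspace (geometric_realization Delta_cover)"
  shows "forget_sign x = forget_sign y \<longleftrightarrow> y = x \<or> y = flip x"
proof
  assume eq: "forget_sign x = forget_sign y"
  obtain r e where r: "r \<in> set Delta_facet_data" "e = 1 \<or> e = - 1" "{w. x w \<noteq> 0} \<subseteq> signed_facet (r, e)"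
    using cover_support[OF x] .
  obtain r' e' where r': "r' \<in> set Delta_facet_data" "e' = 1 \<or> e' = - 1" "{w. y w \<noteq> 0} \<subseteq> signed_facet (r', e')"
    using cover_support[OF y] .
  have xv: "x (v, t) = (if v \<in> facet_vertices r \<and> t = e * facet_sign r v then forget_sign x v else 0)" for v t
    by (rule forget_sign_supported(2)[OF r])
  have yv: "y (v, t) = (if v \<in> facet_vertices r' \<and> t = e' * facet_sign r' v then forget_sign x v else 0)" for v t
    unfolding eq by (rule forget_sign_supported(2)[OF r'])
  have in_r: "v \<in> facet_vertices r" "v \<in> facet_vertices r'" if "forget_sign x v \<noteq> 0" for v
    using forget_sign_supported(1)[OF r, of v] forget_sign_supported(1)[OF r', of v] that
    by (auto simp: eq split: if_splits)
  obtain w where "x w \<noteq> 0" using realization_support_nonempty[OF x] by blast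
  then have "forget_sign x (fst w) \<noteq> 0" using xv[of "fst w" "snd w"] by (auto split: if_splits)
  then obtain u where u: "forget_sign x u \<noteq> 0" ..
  define d where "d = e * facet_sign r u * (e' * facet_sign r' u)"
  have d: "d = 1 \<or> d = - 1"
    using r(2) r'(2) facet_data_on(1)[OF r(1) in_r(1)[OF u]] facet_data_on(1)[OF r'(1) in_r(2)[OF u]] by (auto simp: d_def)
  have sg: "e' * facet_sign r' v = d * (e * facet_sign r v)" if v: "forget_sign x v \<noteq> 0" for v
  proof -
    have "facet_sign r u * facet_sign r v = facet_sign r' u * facet_sign r' v"
      by (rule edge_sign_unique) (use r r' in_r u v in auto)
    then show ?thesis
      using r(2) r'(2) facet_data_on(1)[OF r(1) in_r(1)[OF u]] facet_data_on(1)[OF r'(1) in_r(2)[OF u]]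
      by (auto simp: d_def)
  qed
  have y_eq: "y (v, t) = x (v, d * t)" for v t
  proof (cases "forget_sign x v = 0")
    case True then show ?thesis unfolding xv yv by simp
  next
    case False
    then show ?thesis unfolding xv yv using in_r[OF False] sg[OF False] d by auto
  qed
  from d show "y = x \<or> y = flip x"
    by (elim disjE) (auto simp: fun_eq_iff y_eq flip_def)
next
  assume "y = x \<or> y = flip x"
  then show "forget_sign x = forget_sign y" by (auto simp: forget_sign_def flip_def fun_eq_iff)
qed

lemma finite_complex_Delta: "finite_simplicial_complex Delta"
  unfolding Delta_def Delta_facets_eq_facet_vertices
  by (rule finite_simplicial_complex_generated) (auto simp: finite_facet_vertices)

lemma finite_complex_Delta_cover: "finite_simplicial_complex Delta_cover"
proof -
  have "finite (signed_facet i)" for i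
    by (rule finite_subset[of _ "(\<lambda>v. (v, snd i * facet_sign (fst i) v)) ` facet_vertices (fst i)"])
       (auto simp: signed_facet_def finite_facet_vertices)
  then show ?thesis
    unfolding Delta_cover_def
    by (intro finite_simplicial_complex_generated) (auto simp: signed_index_def)
qed

lemma sum_signed_facet:
  "(\<Sum>w\<in>signed_facet (r, e). f w) = (\<Sum>v\<in>facet_vertices r. f (v, e * facet_sign r v))"
proof -
  have "signed_facet (r, e) = (\<lambda>v. (v, e * facet_sign r v)) ` facet_vertices r"
    by (auto simp: signed_facet_def)
  moreover have "inj_on (\<lambda>v. (v, e * facet_sign r v)) (facet_vertices r)" by (rule inj_onI) simp
  ultimately show ?thesis by (simp add: sum.reindex)
qed

lemma quotient_map_forget_sign:
  "quotient_map (geometric_realization Delta_cover) (geometric_realization Delta) forget_sign"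
proof (rule continuous_imp_quotient_map)
  let ?R = "geometric_realization Delta_cover"
  have im: "forget_sign x \<in> topspace (geometric_realization Delta)" if x: "x \<in> topspace ?R" for x
  proof -
    obtain r e where r: "r \<in> set Delta_facet_data" "e = 1 \<or> e = - 1" "{w. x w \<noteq> 0} \<subseteq> signed_facet (r, e)"
      using cover_support[OF x] .
    note fs = forget_sign_supported(1)[OF r]
    show ?thesis
    proof (rule realizationI[of _ "facet_vertices r"])
      show "0 \<le> forget_sign x v" for v
        using x by (simp add: forget_sign_def topspace_realization)
      show "{v. forget_sign x v \<noteq> 0} \<subseteq> facet_vertices r" using fs by auto
      show "facet_vertices r \<in> Delta" "\<And>G. G \<subseteq> facet_vertices r \<Longrightarrow> G \<in> Delta"
        using r by (auto simp: Delta_def generated_complex_def Delta_facets_eq_facet_vertices)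
      have "(\<Sum>w\<in>signed_facet (r, e). x w) = 1"
        by (rule realization_sum[OF x _ r(3)])
           (auto simp: signed_facet_def intro: finite_subset[of _ "(\<lambda>v. (v, e * facet_sign r v)) ` facet_vertices r"] finite_facet_vertices)
      then show "sum (forget_sign x) (facet_vertices r) = 1"
        by (simp add: sum_signed_facet fs)
    qed (rule finite_facet_vertices)
  qed
  have "continuous_map ?R euclideanreal (\<lambda>x. forget_sign x v)" for v
    unfolding forget_sign_def by (intro continuous_map_add continuous_map_coordinate)
  then show "continuous_map ?R (geometric_realization Delta) forget_sign"
    using im by (simp add: continuous_map_into_realization)
  show "compact_space ?R" by (rule compact_realization[OF finite_complex_Delta_cover])
  show "Hausdorff_space (geometric_realization Delta)" by (rule Hausdorff_realization)
  show "forget_sign ` topspace ?R = topspace (geometric_realization Delta)"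
  proof
    show "forget_sign ` topspace ?R \<subseteq> topspace (geometric_realization Delta)" using im by blast
    show "topspace (geometric_realization Delta) \<subseteq> forget_sign ` topspace ?R"
    proof
      fix y assume y: "y \<in> topspace (geometric_realization Delta)"
      obtain r where r: "r \<in> set Delta_facet_data" "{v. y v \<noteq> 0} \<subseteq> facet_vertices r"
        using y by (auto simp: topspace_realization Delta_def generated_complex_def Delta_facets_eq_facet_vertices)
      define x where "x w = (if w \<in> signed_facet (r, 1) then y (fst w) else 0)" for w
      have xsupp: "{w. x w \<noteq> 0} \<subseteq> signed_facet (r, 1)" by (auto simp: x_def)
      have xval: "x (v, facet_sign r v) = y v" if "v \<in> facet_vertices r" for v
        using that by (simp add: x_def signed_facet_def)
      have "x \<in> topspace ?R"
      proof (rule realizationI[OF _ xsupp])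
        show "0 \<le> x w" for w using y by (simp add: x_def topspace_realization)
        show "signed_facet (r, 1) \<in> Delta_cover" "\<And>G. G \<subseteq> signed_facet (r, 1) \<Longrightarrow> G \<in> Delta_cover"
          using r by (auto simp: Delta_cover_def generated_complex_def signed_index_def)
        then show "finite (signed_facet (r, 1))"
          using finite_complex_Delta_cover by (auto simp: finite_simplicial_complex_def)
        have "(\<Sum>v\<in>facet_vertices r. y v) = 1"
          by (rule realization_sum[OF y finite_facet_vertices r(2)])
        then show "sum x (signed_facet (r, 1)) = 1"
          by (simp add: sum_signed_facet xval)
      qed
      moreover have "forget_sign x = y"
      proof
        fix v show "forget_sign x v = y v"
          using forget_sign_supported(1)[OF r(1) _ xsupp, of v] xval r(2) by auto
      qed
      ultimately show "y \<in> forget_sign ` topspace ?R" by blast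
    qed
  qed
qed

theorem triangulates_Delta: "triangulates Delta (real_projective_space 3)"
proof -
  let ?R = "geometric_realization Delta_cover"
  let ?V = "\<Union>i\<in>signed_index. signed_facet i"
  define g where "g x = sgn (\<Sum>w\<in>?V. x w *\<^sub>R signed_point w)" for x
  have g: "homeomorphic_map ?R (top_of_set (sphere 0 1)) g"
    unfolding g_def[abs_def] by (rule Delta_cover_homeomorphic_sphere)
  have "homeomorphic_map (top_of_set (sphere 0 1)) (nsphere 3) emb4"
    using sphere_homeomorphic_nsphere3 homeomorphic_map_maps by blast
  then have "quotient_map ?R (nsphere 3) (emb4 \<circ> g)"
    using homeomorphic_map_compose[OF g, of "nsphere 3" emb4] unfolding homeomorphic_map_def by blast
  then have q: "quotient_map ?R (real_projective_space 3) (line \<circ> (emb4 \<circ> g))"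
    using quotient_map_line quotient_map_compose by blast
  have Vflip: "(v, - t) \<in> ?V" if "(v, t) \<in> ?V" for v t
  proof -
    from that obtain i where i: "i \<in> signed_index" "(v, t) \<in> signed_facet i" by blast
    obtain r e where "i = (r, e)" by (metis surj_pair)
    then have "r \<in> set Delta_facet_data" "e = 1 \<or> e = - 1" "v \<in> facet_vertices r" "t = e * facet_sign r v"
      using i by (auto simp: signed_index_def signed_facet_def)
    then have "(r, - e) \<in> signed_index" "(v, - t) \<in> signed_facet (r, - e)"
      by (auto simp: signed_index_def signed_facet_def)
    then show ?thesis by blast
  qed
  have gflip: "g (flip x) = - g x" for x
  proof -
    have "(\<Sum>w\<in>?V. flip x w *\<^sub>R signed_point w) = (\<Sum>w\<in>?V. - (x w *\<^sub>R signed_point w))"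
    proof (rule sum.reindex_bij_witness[where i = "\<lambda>w. (fst w, - snd w)" and j = "\<lambda>w. (fst w, - snd w)"])
      show "(fst w, - snd w) \<in> ?V" if "w \<in> ?V" for w using Vflip[of "fst w" "snd w"] that by simp
      then show "(fst w, - snd w) \<in> ?V" if "w \<in> ?V" for w using that .
    qed (auto simp: flip_def signed_point_def)
    then show ?thesis by (simp add: g_def sum_negf sgn_minus)
  qed
  have flipR: "flip x \<in> topspace ?R" if x: "x \<in> topspace ?R" for x
  proof -
    obtain r e where r: "r \<in> set Delta_facet_data" "e = 1 \<or> e = - 1" "{w. x w \<noteq> 0} \<subseteq> signed_facet (r, e)"
      using cover_support[OF x] .
    have ri: "(r, - e) \<in> signed_index" using r by (auto simp: signed_index_def)
    show ?thesis
    proof (rule realizationI[of _ "signed_facet (r, - e)"])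
      show "0 \<le> flip x w" for w using x by (simp add: flip_def topspace_realization)
      show "{w. flip x w \<noteq> 0} \<subseteq> signed_facet (r, - e)"
        using r(3) by (fastforce simp: flip_def signed_facet_def)
      show "signed_facet (r, - e) \<in> Delta_cover" "\<And>G. G \<subseteq> signed_facet (r, - e) \<Longrightarrow> G \<in> Delta_cover"
        using ri by (auto simp: Delta_cover_def generated_complex_def)
      then show "finite (signed_facet (r, - e))"
        using finite_complex_Delta_cover by (auto simp: finite_simplicial_complex_def)
      have "signed_facet (r, e) \<in> Delta_cover"
        using r by (auto simp: Delta_cover_def generated_complex_def signed_index_def)
      then have "(\<Sum>w\<in>signed_facet (r, e). x w) = 1"
        using finite_complex_Delta_cover
        by (intro realization_sum[OF x _ r(3)]) (auto simp: finite_simplicial_complex_def)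
      then show "sum (flip x) (signed_facet (r, - e)) = 1"
        by (simp add: sum_signed_facet flip_def)
    qed
  qed
  have ginj: "x = y" if "x \<in> topspace ?R" "y \<in> topspace ?R" "g x = g y" for x y
    using g that by (auto simp: homeomorphic_eq_everything_map inj_on_def)
  have embinj: "emb4 x = emb4 y \<longleftrightarrow> x = y" for x y
    by (metis pr4_emb4)
  have fib: "forget_sign x = forget_sign y \<longleftrightarrow> (line \<circ> (emb4 \<circ> g)) x = (line \<circ> (emb4 \<circ> g)) y"
    if xy: "x \<in> topspace ?R" "y \<in> topspace ?R" for x y
  proof -
    have "(line \<circ> (emb4 \<circ> g)) x = (line \<circ> (emb4 \<circ> g)) y \<longleftrightarrow> emb4 (g y) = emb4 (g x) \<or> emb4 (g y) = emb4 (- g x)"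
      by (simp only: o_apply line_eq_iff emb4_minus)
    also have "\<dots> \<longleftrightarrow> g y = g x \<or> g y = g (flip x)"
      by (simp only: embinj gflip)
    also have "\<dots> \<longleftrightarrow> y = x \<or> y = flip x"
      using ginj flipR xy by blast
    finally show ?thesis using forget_sign_fibre[OF xy] by simp
  qed
  have "geometric_realization Delta homeomorphic_space real_projective_space 3"
    by (rule quotient_maps_same_fibres_homeomorphic[OF quotient_map_forget_sign q fib])
  then show ?thesis by (simp add: triangulates_def finite_complex_Delta)
qed


section \<open>Combinatorics of the complex\<close>

lemma facets_generated_complex:
  assumes "\<And>F. F \<in> A \<Longrightarrow> finite F \<and> card F = n"
  shows "facets (generated_complex A) = A"
proof
  show "facets (generated_complex A) \<subseteq> A"
    unfolding facets_def generated_complex_def by blast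
  show "A \<subseteq> facets (generated_complex A)"
  proof
    fix F assume F: "F \<in> A"
    have "G = F" if G: "G \<in> generated_complex A" "F \<subseteq> G" for G
    proof -
      obtain H where H: "H \<in> A" "G \<subseteq> H" using G(1) by (auto simp: generated_complex_def)
      have "F = H" by (rule card_subset_eq) (use assms F H G(2) in auto)
      then show ?thesis using H(2) G(2) by blast
    qed
    then show "F \<in> facets (generated_complex A)"
      using F by (auto simp: facets_def generated_complex_def)
  qed
qed

lemma vertex_link_generated_complex:
  "vertex_link v (generated_complex A) = generated_complex ((\<lambda>F. F - {v}) ` {F \<in> A. v \<in> F})"
proof
  show "vertex_link v (generated_complex A) \<subseteq> generated_complex ((\<lambda>F. F - {v}) ` {F \<in> A. v \<in> F})"
  proof
    fix G assume "G \<in> vertex_link v (generated_complex A)"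
    then have "v \<notin> G" "insert v G \<in> generated_complex A" by (simp_all add: vertex_link_def)
    moreover then obtain F where "F \<in> A" "insert v G \<subseteq> F"
      unfolding generated_complex_def by blast
    ultimately have "F \<in> A" "v \<in> F" "G \<subseteq> F - {v}" by blast+
    then show "G \<in> generated_complex ((\<lambda>F. F - {v}) ` {F \<in> A. v \<in> F})"
      unfolding generated_complex_def by blast
  qed
  show "generated_complex ((\<lambda>F. F - {v}) ` {F \<in> A. v \<in> F}) \<subseteq> vertex_link v (generated_complex A)"
  proof
    fix G assume "G \<in> generated_complex ((\<lambda>F. F - {v}) ` {F \<in> A. v \<in> F})"
    then obtain F where F: "F \<in> A" "v \<in> F" "G \<subseteq> F - {v}"
      unfolding generated_complex_def by blast
    then have "v \<notin> G" "G \<subseteq> F" "insert v G \<subseteq> F" by blast+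
    then show "G \<in> vertex_link v (generated_complex A)"
      using F(1) unfolding vertex_link_def generated_complex_def by blast
  qed
qed

lemma inj_on_set_lists:
  assumes "\<forall>F\<in>A. sorted F \<and> distinct F"
  shows "inj_on set (A :: 'a::linorder list set)"
  using assms by (auto simp: inj_on_def intro: sorted_distinct_set_unique)

lemma card_Delta_facets: "card Delta_facets = 72"
proof -
  have "inj_on set (set Delta_list)" using Delta_list_facets(4) by (intro inj_on_set_lists) blast
  then show ?thesis
    unfolding Delta_facets_list using Delta_list_facets(1,2) by (simp add: card_image distinct_card)
qed

lemma card_L_triangles: "card L_triangles = 18"
proof -
  have "inj_on set (set (map (snd \<circ> snd) L_facet_data))" by (intro inj_on_set_lists L_facet_data_triangles(3))
  then show ?thesis
    unfolding L_triangles_list using distinct_card[OF L_facet_data_triangles(2)] L_facet_data_triangles(1) by (simp only: card_image)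
qed

lemma vertices_Delta: "\<Union>Delta = {0..15}"
  using Delta_list_facets(3) by (simp add: Delta_def Union_generated_complex Delta_facets_list)

lemma vertices_L_sphere: "\<Union>L_sphere = {2,3,4,5,6,7,9,10,12,14,15}"
  unfolding L_sphere_def Union_generated_complex L_triangles_list L_points_vertices(3)[symmetric]
  by simp

lemma Delta_facet_card: "F \<in> Delta_facets \<Longrightarrow> finite F \<and> card F = 4"
  unfolding Delta_facets_eq_facet_vertices by (auto simp: card_facet_vertices finite_facet_vertices)

lemma balanced_Delta: "balanced3 Delta"
  unfolding balanced3_def complex_dim_eq_def
proof (intro conjI exI allI impI ballI)
  show "card F \<le> Suc 3" if F: "F \<in> Delta" for F
  proof -
    obtain G where "G \<in> Delta_facets" "F \<subseteq> G" using F by (auto simp: Delta_def generated_complex_def)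
    then show ?thesis using card_mono[of G F] Delta_facet_card[of G] by simp
  qed
  have "Delta_facets \<noteq> {}" using card_Delta_facets by force
  then obtain F where "F \<in> Delta_facets" by blast
  then show "\<exists>F\<in>Delta. card F = Suc 3"
    using Delta_facet_card by (intro bexI[of _ F]) (auto simp: Delta_def generated_complex_def)
  show "(!) colouring ` \<Union>Delta \<subseteq> {1,2,3,4}"
  proof
    fix c assume "c \<in> (!) colouring ` \<Union>Delta"
    then obtain v where "v \<in> {0..15}" "c = colouring ! v" unfolding vertices_Delta by blast
    then have "c \<in> set colouring" using colouring_proper(3) by simp
    then show "c \<in> {1,2,3,4}" unfolding colouring_proper(2) .
  qed
  fix i j :: nat assume ij: "i \<noteq> j" "{i, j} \<in> Delta"
  then obtain F where F: "F \<in> set Delta_list" "i \<in> set F" "j \<in> set F"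
    by (auto simp: Delta_def generated_complex_def Delta_facets_list)
  then have "inj_on ((!) colouring) (set F)" using colouring_proper(1) by (simp add: distinct_map)
  then show "colouring ! i \<noteq> colouring ! j" using F ij(1) by (simp add: inj_on_eq_iff)
qed

lemma simplicial_isomorphism_generated:
  assumes "inj_on f (\<Union>A)" "image f ` A = B"
  shows "simplicial_isomorphism (generated_complex A) (generated_complex B) f"
proof -
  have "image f ` generated_complex A = generated_complex B"
    by (simp add: generated_complex_image assms(2))
  moreover have "f ` \<Union>A = \<Union>B" using assms(2) by blast
  ultimately show ?thesis
    using assms(1) by (simp add: simplicial_isomorphism_def bij_betw_def Union_generated_complex)
qed

lemma centrally_symmetric_Delta: "centrally_symmetric Delta"
  unfolding centrally_symmetric_def
proof (intro exI conjI ballI impI)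
  let ?s = "(!) antipode_list"
  have inv: "?s v < 16 \<and> ?s (?s v) = v" if "v < 16" for v
    using antipode_list_free(2) that by simp
  have vert: "v < 16" if "F \<in> Delta_facets" "v \<in> F" for F v
    using that vertices_Delta by (force simp: Delta_def Union_generated_complex)
  have im: "?s ` F \<in> Delta_facets" if F: "F \<in> Delta_facets" for F
  proof -
    obtain xs where xs: "xs \<in> set Delta_list" "F = set xs" using F by (auto simp: Delta_facets_list)
    then have "sort (map ?s xs) \<in> set Delta_list" using antipode_list_free(1) by blast
    then have "set (sort (map ?s xs)) \<in> Delta_facets" unfolding Delta_facets_list by blast
    then show ?thesis by (simp add: xs(2))
  qed
  have "image ?s ` Delta_facets = Delta_facets"
  proof
    show "image ?s ` Delta_facets \<subseteq> Delta_facets" using im by blast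
    show "Delta_facets \<subseteq> image ?s ` Delta_facets"
    proof
      fix F assume F: "F \<in> Delta_facets"
      have "?s ` ?s ` F = (\<lambda>v. v) ` F"
        unfolding image_image by (rule image_cong) (use inv vert[OF F] in auto)
      then show "F \<in> image ?s ` Delta_facets" using im[OF F] by (metis image_eqI image_ident)
    qed
  qed
  moreover have "inj_on ?s (\<Union>Delta_facets)"
    by (rule inj_onI) (metis UnionE inv vert)
  ultimately show "simplicial_isomorphism Delta Delta ?s"
    unfolding Delta_def by (intro simplicial_isomorphism_generated)
  show "?s (?s v) = v" if "v \<in> \<Union>Delta" for v
    using that inv unfolding vertices_Delta by simp
  fix F assume F: "F \<in> Delta" "F \<noteq> {}"
  then obtain xs v where xs: "xs \<in> set Delta_list" "F \<subseteq> set xs" "v \<in> F"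
    by (auto simp: Delta_def generated_complex_def Delta_facets_list)
  then have "?s v \<notin> set xs" using antipode_list_free(1) by blast
  then show "?s ` F \<noteq> F" using xs by blast
qed

lemma links_Delta:
  assumes v: "v \<in> \<Union>Delta"
  shows "simplicially_isomorphic (vertex_link v Delta) L_sphere"
proof -
  have v16: "v \<in> {0..<16}" using v unfolding vertices_Delta by auto
  define f where "f = (!) (link_maps ! v)"
  let ?A = "(\<lambda>F. F - {v}) ` {F \<in> Delta_facets. v \<in> F}"
  note chk = bspec[OF link_maps_isomorphic v16]
  have "image f ` ?A = L_triangles"
  proof -
    have "L_triangles = set ` set (map (\<lambda>F. sort (map f (remove1 v F))) (filter (\<lambda>F. v \<in> set F) Delta_list))"
      unfolding L_triangles_list f_def using chk by simp
    also have "\<dots> = (\<lambda>F. f ` (set F - {v})) ` {F \<in> set Delta_list. v \<in> set F}"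
      unfolding set_map set_filter image_image
      by (rule image_cong) (use Delta_list_facets(4) in auto)
    also have "\<dots> = image f ` ?A"
      unfolding Delta_facets_list by auto
    finally show ?thesis by simp
  qed
  moreover have "inj_on f (\<Union>?A)"
  proof (rule inj_on_subset)
    show "inj_on f {0..<16}" unfolding f_def using chk by (intro inj_on_nth) auto
    have "\<Union>?A \<subseteq> \<Union>Delta_facets" by blast
    also have "\<dots> = {0..15}" using vertices_Delta by (simp add: Delta_def Union_generated_complex)
    finally show "\<Union>?A \<subseteq> {0..<16}" by auto
  qed
  ultimately have "simplicial_isomorphism (generated_complex ?A) L_sphere f"
    unfolding L_sphere_def by (intro simplicial_isomorphism_generated)
  then show ?thesis
    unfolding simplicially_isomorphic_def Delta_def vertex_link_generated_complex by blast
qed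


section \<open>The theorem\<close>

theorem mainTheorem4:
  shows "card Delta_facets = 72 \<and> facets Delta = Delta_facets \<and> \<Union>Delta = {0..15}
    \<and> card L_triangles = 18 \<and> \<Union>L_sphere = {2,3,4,5,6,7,9,10,12,14,15}
    \<and> triangulates L_sphere (nsphere 2)
    \<and> balanced3 Delta
    \<and> triangulates Delta (real_projective_space 3)
    \<and> card (\<Union>Delta) = 16
    \<and> centrally_symmetric Delta
    \<and> (\<forall>v\<in>\<Union>Delta. simplicially_isomorphic (vertex_link v Delta) L_sphere)
    \<and> (\<forall>K :: 'v set set.
          balanced3 K \<and> triangulates K (real_projective_space 3) \<longrightarrow> 16 \<le> card (\<Union>K))"
proof (intro conjI ballI allI impI)
  show "facets Delta = Delta_facets"
    unfolding Delta_def by (rule facets_generated_complex[OF Delta_facet_card])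
  show "card (\<Union>Delta) = 16" unfolding vertices_Delta by simp
  show "16 \<le> card (\<Union>K)" if "balanced3 K \<and> triangulates K (real_projective_space 3)" for K :: "'v set set"
    using that balanced_RP3_vertices by blast
qed (fact card_Delta_facets vertices_Delta card_L_triangles vertices_L_sphere triangulates_L_sphere
      balanced_Delta triangulates_Delta centrally_symmetric_Delta links_Delta)+

end
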